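(* There is an algorithm that, given a deMorgan formula $F$ of size $s$ over $n$ variables, computes a text $t$ and a regular expression $p$ over a constant-size alphabet, with $|t|$ and $|p|$ both at most $N = O(2^{n/2}\cdot s\log s)$, such that $p$ matches some substring of $t$ if and only if $F$ is satisfiable. The algorithm runs in time $O(N)$.
   Context: A deMorgan formula over variables $z_1,\dots,z_n$ is a rooted tree whose leaves are labelled by variables or their negations and whose internal gates are AND or OR gates; its size is the number of leaves. Regular expressions over an alphabet $\Sigma$ are built from single symbols $c\in\Sigma$ (matching the string $c$), concatenation $r_1 r_2$ (matching $s_1s_2$ with $s_i$ matched by $r_i$), union $r_1|r_2$ (matching strings matched by $r_1$ or $r_2$), and Kleene star $r^*$ (matching concatenations of zero or more strings matched by $r$). The size of a regular expression is its length. *)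

theory Defs
  imports Complex_Main "HOL-Library.Sublist"
begin

section \<open>DeMorgan formulas\<close>

datatype formula =
    Pos nat
  | Neg nat
  | And formula formula
  | Or formula formula

fun holds :: "(nat \<Rightarrow> bool) \<Rightarrow> formula \<Rightarrow> bool" where
  "holds \<alpha> (Pos i) = \<alpha> i"
| "holds \<alpha> (Neg i) = (\<not> \<alpha> i)"
| "holds \<alpha> (And F G) = (holds \<alpha> F \<and> holds \<alpha> G)"
| "holds \<alpha> (Or F G) = (holds \<alpha> F \<or> holds \<alpha> G)"

definition satisfiable :: "formula \<Rightarrow> bool" where
  "satisfiable F \<longleftrightarrow> (\<exists>\<alpha>. holds \<alpha> F)"

fun fvars :: "formula \<Rightarrow> nat set" where
  "fvars (Pos i) = {i}"
| "fvars (Neg i) = {i}"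
| "fvars (And F G) = fvars F \<union> fvars G"
| "fvars (Or F G) = fvars F \<union> fvars G"

fun leaves :: "formula \<Rightarrow> nat" where
  "leaves (Pos i) = 1"
| "leaves (Neg i) = 1"
| "leaves (And F G) = leaves F + leaves G"
| "leaves (Or F G) = leaves F + leaves G"


section \<open>Regular expressions\<close>

datatype 'a rexp =
    Sym 'a
  | Conc "'a rexp" "'a rexp"
  | Union "'a rexp" "'a rexp"
  | Star "'a rexp"

fun lang :: "'a rexp \<Rightarrow> 'a list set" where
  "lang (Sym c) = {[c]}"
| "lang (Conc r s) = {u @ v | u v. u \<in> lang r \<and> v \<in> lang s}"
| "lang (Union r s) = lang r \<union> lang s"
| "lang (Star r) = {concat us | us. set us \<subseteq> lang r}"

text \<open>The length of a regular expression is the length of the string that denotes it.  Brackets are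
  written around every concatenation and every union, so that the string determines the
  expression; they count towards the length.\<close>

datatype 'a token = Chr 'a | LPar | RPar | Bar | Ast

fun rexp_string :: "'a rexp \<Rightarrow> 'a token list" where
  "rexp_string (Sym c) = [Chr c]"
| "rexp_string (Conc r s) = [LPar] @ rexp_string r @ rexp_string s @ [RPar]"
| "rexp_string (Union r s) = [LPar] @ rexp_string r @ [Bar] @ rexp_string s @ [RPar]"
| "rexp_string (Star r) = rexp_string r @ [Ast]"

definition rexp_length :: "'a rexp \<Rightarrow> nat" where
  "rexp_length r = length (rexp_string r)"


section \<open>Word RAM\<close>

text \<open>Programs run on registers and a random-access memory, all of whose cells hold \<open>w\<close>-bit words,
  represented as natural numbers below \<open>2 ^ w\<close>.  The program does not depend on \<open>w\<close>.  Control flow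
  is structured instead of given by jumps, which changes running times by a constant factor only.
  Multiplication and division are left out; the operations that remain have unit cost in
  all common variants of the model, so omitting the others only makes running times larger.\<close>

datatype binop = Add | Sub | BitAnd | BitOr | BitXor | Shl | Shr | Eq | Less

datatype expr =
    Const nat
  | Reg nat
  | Mem expr
  | Op binop expr expr

datatype program =
    Skip
  | Assign nat expr
  | Store expr expr
  | Seq program program
  | If expr program program
  | While expr program

type_synonym state = "(nat \<Rightarrow> nat) \<times> (nat \<Rightarrow> nat)"

context
  includes bit_operations_syntax
begin

text \<open>Addition, subtraction and left shift wrap around.\<close>

fun binop_val :: "nat \<Rightarrow> binop \<Rightarrow> nat \<Rightarrow> nat \<Rightarrow> nat" where
  "binop_val w Add a b = (a + b) mod 2 ^ w"
| "binop_val w Sub a b = nat ((int a - int b) mod 2 ^ w)"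
| "binop_val w BitAnd a b = a AND b"
| "binop_val w BitOr a b = a OR b"
| "binop_val w BitXor a b = a XOR b"
| "binop_val w Shl a b = (a * 2 ^ b) mod 2 ^ w"
| "binop_val w Shr a b = a div 2 ^ b"
| "binop_val w Eq a b = of_bool (a = b) mod 2 ^ w"
| "binop_val w Less a b = of_bool (a < b) mod 2 ^ w"

end

fun expr_val :: "nat \<Rightarrow> state \<Rightarrow> expr \<Rightarrow> nat" where
  "expr_val w st (Const k) = k mod 2 ^ w"
| "expr_val w st (Reg r) = fst st r"
| "expr_val w st (Mem e) = snd st (expr_val w st e)"
| "expr_val w st (Op f d e) = binop_val w f (expr_val w st d) (expr_val w st e)"

fun expr_time :: "expr \<Rightarrow> nat" where
  "expr_time (Const k) = 1"
| "expr_time (Reg r) = 1"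
| "expr_time (Mem e) = 1 + expr_time e"
| "expr_time (Op f d e) = 1 + expr_time d + expr_time e"

text \<open>\<open>exec w P st T st'\<close>: started in \<open>st\<close>, the program \<open>P\<close> halts in \<open>st'\<close> after exactly \<open>T\<close> steps.\<close>

inductive exec :: "nat \<Rightarrow> program \<Rightarrow> state \<Rightarrow> nat \<Rightarrow> state \<Rightarrow> bool" for w where
  Skip: "exec w Skip st 1 st"
| Assign: "exec w (Assign r e) (R, M) (1 + expr_time e) (R(r := expr_val w (R, M) e), M)"
| Store: "exec w (Store d e) (R, M) (1 + expr_time d + expr_time e)
    (R, M(expr_val w (R, M) d := expr_val w (R, M) e))"
| Seq: "exec w P st T1 st1 \<Longrightarrow> exec w Q st1 T2 st2 \<Longrightarrow> exec w (Seq P Q) st (T1 + T2) st2"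
| IfTrue: "expr_val w st e \<noteq> 0 \<Longrightarrow> exec w P st T st1 \<Longrightarrow>
    exec w (If e P Q) st (1 + expr_time e + T) st1"
| IfFalse: "expr_val w st e = 0 \<Longrightarrow> exec w Q st T st1 \<Longrightarrow>
    exec w (If e P Q) st (1 + expr_time e + T) st1"
| WhileFalse: "expr_val w st e = 0 \<Longrightarrow> exec w (While e P) st (1 + expr_time e) st"
| WhileTrue: "expr_val w st e \<noteq> 0 \<Longrightarrow> exec w P st T1 st1 \<Longrightarrow> exec w (While e P) st1 T2 st2 \<Longrightarrow>
    exec w (While e P) st (1 + expr_time e + T1 + T2) st2"

text \<open>The input is placed at the start of the memory and its length in register 0; everything else
  is 0.  On halting, register 0 points to the output and register 1 holds its length.\<close>

definition initial_state :: "nat list \<Rightarrow> state" where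
  "initial_state xs =
    ((\<lambda>r. if r = 0 then length xs else 0), (\<lambda>a. if a < length xs then xs ! a else 0))"

definition computes_within :: "nat \<Rightarrow> program \<Rightarrow> nat list \<Rightarrow> nat list \<Rightarrow> nat \<Rightarrow> bool" where
  "computes_within w P xs ys T \<longleftrightarrow>
    length xs < 2 ^ w \<and> (\<forall>x \<in> set xs. x < 2 ^ w) \<and>
    (\<exists>T' R M. exec w P (initial_state xs) T' (R, M) \<and> T' \<le> T \<and>
      R 0 + R 1 \<le> 2 ^ w \<and> map M [R 0..<R 0 + R 1] = ys)"


section \<open>Encoding of the input and the output as sequences of words\<close>

text \<open>Formulas are written in prefix notation.\<close>

fun formula_code :: "formula \<Rightarrow> nat list" where
  "formula_code (And F G) = [0] @ formula_code F @ formula_code G"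
| "formula_code (Or F G) = [1] @ formula_code F @ formula_code G"
| "formula_code (Pos i) = [2 * i + 2]"
| "formula_code (Neg i) = [2 * i + 3]"

definition input_code :: "nat \<Rightarrow> formula \<Rightarrow> nat list" where
  "input_code n F = n # formula_code F"

fun token_code :: "nat token \<Rightarrow> nat" where
  "token_code LPar = 0"
| "token_code RPar = 1"
| "token_code Bar = 2"
| "token_code Ast = 3"
| "token_code (Chr c) = c + 4"

definition output_code :: "nat list \<Rightarrow> nat rexp \<Rightarrow> nat list" where
  "output_code t p = length t # t @ map token_code (rexp_string p)"

end

theory Submission
  imports Defs "HOL-Library.Discrete_Functions"
begin

text \<open>Split the variables into two halves of size at most \<open>H = \<lceil>n/2\<rceil>\<close> and number the leaves of \<open>F\<close> in their order from left to
  right.  The text has one block for each assignment \<open>x\<close> of the first half; the block lists all leaves, each as its number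
  together with its truth value, where the leaves on the second half count as true.  The pattern is the union, over the
  assignments \<open>y\<close> of the second half, of expressions obtained from \<open>F\<close> by reading conjunction as concatenation and
  disjunction as union, where a leaf becomes ``skip anything, then see this leaf with value true'', or with value false,
  which never happens, if \<open>y\<close> makes it false.  A conjunction visits its two sides from left to right, so the
  order of the leaves in the block suits every way to satisfy \<open>F\<close>, and skipping needs no padding.  The numbers of the leaves
  cost the factor \<open>log s\<close>.

  Both strings are printed by nested loops over \<open>x\<close> or \<open>y\<close>, over a flat token list of the formula, and over the
  binary digits of a leaf number, so the running time is proportional to the output.  Only the token list needs a
  stack, and it is made once.\<close>

section \<open>Leaf words\<close>

text \<open>Least significant digit first and no digit for 0, which is the order in which repeated
  masking and shifting until zero produces the digits.\<close>

fun bin_digits :: "nat \<Rightarrow> nat list" where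
  "bin_digits k = (if k = 0 then [] else k mod 2 # bin_digits (k div 2))"

declare bin_digits.simps [simp del]

lemma bin_digits_0 [simp]: "bin_digits 0 = []"
  by (simp add: bin_digits.simps)

lemma bin_digits_pos: "0 < k \<Longrightarrow> bin_digits k = k mod 2 # bin_digits (k div 2)"
  by (simp add: bin_digits.simps)

lemma set_bin_digits: "set (bin_digits k) \<subseteq> {..<2}"
  by (induction k rule: bin_digits.induct) (subst bin_digits.simps, auto)

lemma bin_digits_inject: "bin_digits k = bin_digits l \<Longrightarrow> k = l"
proof (induction k arbitrary: l rule: bin_digits.induct)
  case (1 k)
  show ?case
  proof (cases "k = 0 \<or> l = 0")
    case True
    then show ?thesis
      using "1.prems" by (cases "k = 0"; cases "l = 0") (auto simp: bin_digits_pos)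
  next
    case False
    then have "k mod 2 = l mod 2" and "bin_digits (k div 2) = bin_digits (l div 2)"
      using "1.prems" by (auto simp: bin_digits_pos)
    moreover from this(2) have "k div 2 = l div 2"
      using "1.IH" False by blast
    ultimately show ?thesis
      by (metis div_mult_mod_eq)
  qed
qed

lemma length_bin_digits: "k < 2 ^ L \<Longrightarrow> length (bin_digits k) \<le> L"
proof (induction k arbitrary: L rule: bin_digits.induct)
  case (1 k)
  show ?case
  proof (cases "k = 0")
    case False
    then obtain M where L: "L = Suc M"
      using "1.prems" by (cases L) auto
    then have "k div 2 < 2 ^ M"
      using "1.prems" by (simp add: less_mult_imp_div_less mult.commute)
    then show ?thesis
      using "1.IH" False L by (simp add: bin_digits_pos)
  qed simp
qed

text \<open>The terminator 2 makes numbers self-delimiting. The symbols \<open>v\<close> in use are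
  3 and 4, so they differ from digits and terminator and mark where a word starts.\<close>

definition leaf_word :: "nat \<Rightarrow> nat \<Rightarrow> nat list" where
  "leaf_word v k = v # bin_digits k @ [2]"

lemma two_notin_bin_digits: "2 \<notin> set (bin_digits k)"
  using set_bin_digits[of k] by auto

text \<open>Reading up to the first 2 recovers the digits on both sides, and the digits determine
  the number.\<close>

lemma leaf_word_prefix:
  assumes "prefix (leaf_word v k) (leaf_word v' k' @ zs)"
  shows "v = v' \<and> k = k'"
proof -
  have "takeWhile (\<lambda>c. c \<noteq> 2) (bin_digits l @ 2 # ys) = bin_digits l" for l ys
    using two_notin_bin_digits[of l] by (subst takeWhile_append2) auto
  then have "bin_digits k = bin_digits k'" if "bin_digits k @ 2 # ys = bin_digits k' @ 2 # zs" for ys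
    using that by metis
  then show ?thesis
    using assms by (auto simp: leaf_word_def prefix_def bin_digits_inject)
qed

lemma sublist_Cons_append_notin:
  "c \<notin> set ys \<Longrightarrow> sublist (c # u) (ys @ zs) \<longleftrightarrow> sublist (c # u) zs"
  by (induction ys) (auto simp: sublist_Cons_right)

text \<open>An occurrence that is not at the very start cannot begin among the digits or at the
  terminator, since these are below 3; so it lies entirely in the remainder.\<close>

lemma leaf_word_sublist_Cons:
  assumes "3 \<le> v" "sublist (leaf_word v k) (leaf_word v' k' @ zs)"
  shows "v = v' \<and> k = k' \<or> sublist (leaf_word v k) zs"
proof (cases "prefix (leaf_word v k) (leaf_word v' k' @ zs)")
  case False
  have "v \<notin> set (bin_digits k' @ [2])"
    using assms(1) set_bin_digits[of k'] by auto
  moreover have "sublist (leaf_word v k) ((bin_digits k' @ [2]) @ zs)"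
    using assms(2) False by (auto simp: leaf_word_def[of v'] sublist_Cons_right)
  ultimately have "sublist (leaf_word v k) zs"
    unfolding leaf_word_def[of v k] by (metis sublist_Cons_append_notin)
  then show ?thesis ..
qed (use leaf_word_prefix in blast)


section \<open>Formulas as token sequences\<close>

text \<open>Leaves are handled as layout entries, \<open>2 * i + 4\<close> for \<open>Pos i\<close>
  and \<open>2 * i + 5\<close> for \<open>Neg i\<close>: halving gives the variable and parity gives
  the sign.\<close>

fun leaf_holds :: "(nat \<Rightarrow> bool) \<Rightarrow> nat \<Rightarrow> bool" where
  "leaf_holds \<alpha> e = (\<alpha> (e div 2 - 2) \<noteq> odd e)"

text \<open>Below 4, the entries are the codes of the three punctuation tokens of regular expressions; a leaf is
  2 plus its code.\<close>

fun layout :: "formula \<Rightarrow> nat list" where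
  "layout (Pos i) = [2 * i + 4]"
| "layout (Neg i) = [2 * i + 5]"
| "layout (And F G) = 0 # layout F @ layout G @ [1]"
| "layout (Or F G) = 0 # layout F @ 2 # layout G @ [1]"

lemma leaves_pos: "0 < leaves F"
  by (induction F) auto

lemma length_layout: "length (layout F) + 3 \<le> 4 * leaves F"
  by (induction F) auto

text \<open>A leaf is numbered by the position of its entry. Punctuation leaves gaps in the
  numbering, which do no harm because the numbers only have to be distinct.\<close>

definition text_entry :: "(nat \<Rightarrow> nat) \<Rightarrow> nat \<times> nat \<Rightarrow> nat list" where
  "text_entry f = (\<lambda>(k, e). if e < 4 then [] else leaf_word (f e) k)"

text \<open>The offset \<open>k\<close> will be the length of the input, so that the number of a
  leaf is the memory address of its entry.\<close>

definition text_block :: "(nat \<Rightarrow> nat) \<Rightarrow> nat \<Rightarrow> formula \<Rightarrow> nat list" where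
  "text_block f k F = concat (map (text_entry f) (enumerate k (layout F)))"

text \<open>These are the symbols of the blocks. The block separator 5 is left out, so skipping
  never leaves a block.\<close>

definition any_rexp :: "nat rexp" where
  "any_rexp = Union (Sym 0) (Union (Sym 1) (Union (Sym 2) (Union (Sym 3) (Sym 4))))"

definition leaf_rexp :: "nat \<Rightarrow> nat \<Rightarrow> nat rexp" where
  "leaf_rexp v k = Conc (Star any_rexp) (foldr Conc (map Sym (v # bin_digits k)) (Sym 2))"

text \<open>The offsets follow \<open>layout\<close>: an opening bracket precedes the left side, and
  a disjunction has one more entry, the bar, before its right side.\<close>

fun pattern :: "(nat \<Rightarrow> nat) \<Rightarrow> nat \<Rightarrow> formula \<Rightarrow> nat rexp" where
  "pattern g k (Pos i) = leaf_rexp (g (2 * i + 4)) k"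
| "pattern g k (Neg i) = leaf_rexp (g (2 * i + 5)) k"
| "pattern g k (And F G) = Conc (pattern g (k + 1) F) (pattern g (k + 1 + length (layout F)) G)"
| "pattern g k (Or F G) = Union (pattern g (k + 1) F) (pattern g (k + 2 + length (layout F)) G)"

section \<open>Languages and symbols of the expressions and of the text\<close>

lemma lang_any_star: "lang (Star any_rexp) = {us. set us \<subseteq> {..<5}}" (is "?A = ?B")
proof
  have any: "lang any_rexp = (\<lambda>c. [c]) ` {..<5}"
    by (auto simp: any_rexp_def)
  show "?A \<subseteq> ?B"
  proof
    fix u assume "u \<in> ?A"
    then obtain us where u: "u = concat us" and us: "set us \<subseteq> (\<lambda>c. [c]) ` {..<5}"
      by (auto simp: any)
    have "set (concat us) \<subseteq> {..<5}"
      using us by (induction us) auto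
    then show "u \<in> ?B"
      using u by simp
  qed
  show "?B \<subseteq> ?A"
  proof
    fix u :: "nat list" assume "u \<in> ?B"
    \<comment> \<open>Cut the word into one-letter words, each of which matches the union.\<close>
    moreover have "u = concat (map (\<lambda>c. [c]) u)"
      by simp
    ultimately show "u \<in> ?A"
      unfolding lang.simps any by (smt (verit) image_mono list.set_map mem_Collect_eq)
  qed
qed

lemma lang_foldr_Sym: "lang (foldr Conc (map Sym w) r) = {w @ u | u. u \<in> lang r}"
  by (induction w) auto

lemma lang_leaf_rexp: "lang (leaf_rexp v k) = {z @ leaf_word v k | z. set z \<subseteq> {..<5}}"
  unfolding leaf_rexp_def lang.simps(2) lang_any_star lang_foldr_Sym
  by (auto simp: leaf_word_def)

text \<open>Needed to confine a match to one block: symbols of a match come from the expression, and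
  the separator is not among those of \<open>pattern\<close>.\<close>

lemma lang_set_rexp: "u \<in> lang r \<Longrightarrow> set u \<subseteq> set_rexp r"
proof (induction r arbitrary: u)
  case (Star r)
  then obtain us where u: "u = concat us" and us: "set us \<subseteq> lang r"
    by auto
  have "set (concat us) \<subseteq> set_rexp r"
    using us Star.IH by (induction us) auto
  then show ?case
    using u by simp
next
  case (Conc r1 r2)
  then show ?case
    by fastforce
qed auto

lemma set_rexp_leaf_rexp: "set_rexp (leaf_rexp v k) \<subseteq> insert v {..<5}"
proof -
  have "set_rexp (foldr Conc (map Sym w) (Sym 2)) = insert 2 (set w)" for w :: "nat list"
    by (induction w) auto
  then show ?thesis
    using set_bin_digits[of k] by (auto simp: leaf_rexp_def any_rexp_def simp del: foldr.simps list.map)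
qed

lemma set_rexp_pattern:
  assumes "\<And>e. g e < 5"
  shows "set_rexp (pattern g k F) \<subseteq> {..<5}"
proof (induction F arbitrary: k)
  case (Pos i)
  show ?case
    using set_rexp_leaf_rexp[of "g (2 * i + 4)" k] assms[of "2 * i + 4"] by auto
next
  case (Neg i)
  show ?case
    using set_rexp_leaf_rexp[of "g (2 * i + 5)" k] assms[of "2 * i + 5"] by auto
qed auto

lemma set_text_block:
  assumes "\<And>e. f e < 5"
  shows "set (text_block f k F) \<subseteq> {..<5}"
proof -
  have "set (text_entry f p) \<subseteq> {..<5}" for p
    using assms[of "snd p"] set_bin_digits[of "fst p"]
    by (auto simp: text_entry_def leaf_word_def split: prod.splits)
  then show ?thesis
    by (auto simp: text_block_def)
qed

lemma text_block_simps [simp]: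
  "text_block f k (Pos i) = leaf_word (f (2 * i + 4)) k"
  "text_block f k (Neg i) = leaf_word (f (2 * i + 5)) k"
  "text_block f k (And F G) = text_block f (k + 1) F @ text_block f (k + 1 + length (layout F)) G"
  "text_block f k (Or F G) = text_block f (k + 1) F @ text_block f (k + 2 + length (layout F)) G"
  by (simp_all add: text_block_def text_entry_def enumerate_append_eq)


section \<open>Correctness of the reduction\<close>

text \<open>The words of the block are peeled off one at a time; by
  \<open>leaf_word_sublist_Cons\<close> no occurrence straddles two of them.\<close>

lemma leaf_word_sublist_text_block:
  assumes "3 \<le> v" "sublist (leaf_word v k) (concat (map (text_entry f) ps))"
  shows "\<exists>e. (k, e) \<in> set ps \<and> v = f e"
  using assms(2)
proof (induction ps)
  case Nil
  then show ?case
    by (simp add: leaf_word_def)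
next
  case (Cons p ps)
  obtain k' e where p: "p = (k', e)"
    by force
  show ?case
  proof (cases "e < 4")
    case True
    then show ?thesis
      using Cons p by (auto simp: text_entry_def)
  next
    case False
    then have "sublist (leaf_word v k) (leaf_word (f e) k' @ concat (map (text_entry f) ps))"
      using Cons.prems p by (simp add: text_entry_def)
    from leaf_word_sublist_Cons[OF assms(1) this] show ?thesis
      using Cons.IH p by auto
  qed
qed

text \<open>The words of different leaves are distinguished by the numbers in them, so each leaf that the pattern visits
  has been compared with its own value in the text.\<close>

lemma pattern_sound:
  assumes g: "\<And>e. 3 \<le> g e"
    and val: "\<And>e. f e = g e \<Longrightarrow> leaf_holds \<alpha> e"
    and "u \<in> lang (pattern g k F)"
    and "\<And>k' v. 3 \<le> v \<Longrightarrow> sublist (leaf_word v k') u \<Longrightarrow> \<exists>e. (k', e) \<in> E \<and> v = f e"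
    and "set (enumerate k (layout F)) \<subseteq> E"
    and fn: "\<And>k e e'. (k, e) \<in> E \<Longrightarrow> (k, e') \<in> E \<Longrightarrow> e = e'"
  shows "holds \<alpha> F"
  using assms(3-5)
proof (induction F arbitrary: k u)
  case (Pos i)
  have "sublist (leaf_word (g (2 * i + 4)) k) u"
    using Pos.prems(1) by (auto simp: lang_leaf_rexp)
  then obtain e where "(k, e) \<in> E" "g (2 * i + 4) = f e"
    using Pos.prems(2) g by blast
  \<comment> \<open>The number \<open>k\<close> belongs to one entry of \<open>E\<close> only,
    namely this leaf, so the symbol found is the symbol that the text shows for this very
    leaf.\<close>
  then have "f (2 * i + 4) = g (2 * i + 4)"
    using fn[of k e "2 * i + 4"] Pos.prems(3) by auto
  from val[OF this] show ?case
    by simp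
next
  case (Neg i)
  have "sublist (leaf_word (g (2 * i + 5)) k) u"
    using Neg.prems(1) by (auto simp: lang_leaf_rexp)
  then obtain e where "(k, e) \<in> E" "g (2 * i + 5) = f e"
    using Neg.prems(2) g by blast
  then have "f (2 * i + 5) = g (2 * i + 5)"
    using fn[of k e "2 * i + 5"] Neg.prems(3) by auto
  from val[OF this] show ?case
    by simp
next
  case (And F G)
  obtain u1 u2 where u: "u = u1 @ u2"
    and u1: "u1 \<in> lang (pattern g (k + 1) F)"
    and u2: "u2 \<in> lang (pattern g (k + 1 + length (layout F)) G)"
    using And.prems(1) by auto
  have "holds \<alpha> F"
  proof (rule And.IH(1)[OF u1])
    show "\<exists>e. (k', e) \<in> E \<and> v = f e" if "3 \<le> v" "sublist (leaf_word v k') u1" for k' v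
      using that And.prems(2) by (auto simp: u sublist_append)
  qed (use And.prems(3) in \<open>auto simp: enumerate_append_eq\<close>)
  moreover have "holds \<alpha> G"
  proof (rule And.IH(2)[OF u2])
    show "\<exists>e. (k', e) \<in> E \<and> v = f e" if "3 \<le> v" "sublist (leaf_word v k') u2" for k' v
      using that And.prems(2) by (auto simp: u sublist_append)
  qed (use And.prems(3) in \<open>auto simp: enumerate_append_eq\<close>)
  ultimately show ?case
    by simp
next
  case (Or F G)
  consider "u \<in> lang (pattern g (k + 1) F)" | "u \<in> lang (pattern g (k + 2 + length (layout F)) G)"
    using Or.prems(1) by auto
  then show ?case
  proof cases
    case 1
    have "holds \<alpha> F"
      using Or.prems by (intro Or.IH(1)[OF 1]) (auto simp: enumerate_append_eq)
    then show ?thesis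
      by simp
  next
    case 2
    have "holds \<alpha> G"
      using Or.prems by (intro Or.IH(2)[OF 2]) (auto simp: enumerate_append_eq)
    then show ?thesis
      by simp
  qed
qed

text \<open>The prefix \<open>z\<close> stands for the leaves that the pattern skips by the star in front of the next one.\<close>

lemma pattern_complete:
  assumes f: "\<And>e. f e < 5"
    and val: "\<And>e. leaf_holds \<alpha> e \<Longrightarrow> e div 2 - 2 \<in> V \<Longrightarrow> f e = g e"
    and "holds \<alpha> F" and "fvars F \<subseteq> V"
  shows "\<exists>u v. text_block f k F = u @ v \<and> (\<forall>z. set z \<subseteq> {..<5} \<longrightarrow> z @ u \<in> lang (pattern g k F))"
  using assms(3,4)
proof (induction F arbitrary: k)
  case (Pos i)
  then have "f (2 * i + 4) = g (2 * i + 4)"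
    by (intro val) auto
  then show ?case
    by (auto simp: lang_leaf_rexp)
next
  case (Neg i)
  then have "f (2 * i + 5) = g (2 * i + 5)"
    by (intro val) auto
  then show ?case
    by (auto simp: lang_leaf_rexp)
next
  case (And F G)
  obtain u v where F: "text_block f (k + 1) F = u @ v"
      "\<And>z. set z \<subseteq> {..<5} \<Longrightarrow> z @ u \<in> lang (pattern g (k + 1) F)"
    using And.IH(1)[of "k + 1"] And.prems by auto
  obtain u' v' where G: "text_block f (k + 1 + length (layout F)) G = u' @ v'"
      "\<And>z. set z \<subseteq> {..<5} \<Longrightarrow> z @ u' \<in> lang (pattern g (k + 1 + length (layout F)) G)"
    using And.IH(2)[of "k + 1 + length (layout F)"] And.prems by auto
  have v: "set v \<subseteq> {..<5}"
    using set_text_block[of f "k + 1" F, OF f] F(1) by auto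
  have "(z @ u) @ (v @ u') \<in> lang (pattern g k (And F G))" if "set z \<subseteq> {..<5}" for z
    using F(2)[OF that] G(2)[OF v] by (simp only: pattern.simps lang.simps) blast
  then show ?case
    using F(1) G(1) by (intro exI[of _ "u @ v @ u'"] exI[of _ v']) simp
next
  case (Or F G)
  show ?case
  proof (cases "holds \<alpha> F")
    case True
    then obtain u v where F: "text_block f (k + 1) F = u @ v"
        "\<And>z. set z \<subseteq> {..<5} \<Longrightarrow> z @ u \<in> lang (pattern g (k + 1) F)"
      using Or.IH(1)[of "k + 1"] Or.prems by auto
    then show ?thesis
      by (intro exI[of _ u] exI[of _ "v @ text_block f (k + 2 + length (layout F)) G"]) simp
  next
    case False
    then obtain u v where G: "text_block f (k + 2 + length (layout F)) G = u @ v"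
        "\<And>z. set z \<subseteq> {..<5} \<Longrightarrow> z @ u \<in> lang (pattern g (k + 2 + length (layout F)) G)"
      using Or.IH(2)[of "k + 2 + length (layout F)"] Or.prems by auto
    \<comment> \<open>When only the right side holds, the whole block of the left side is
      skipped.\<close>
    have "set (text_block f (k + 1) F) \<subseteq> {..<5}"
      by (rule set_text_block[OF f])
    then have "z @ text_block f (k + 1) F @ u \<in> lang (pattern g k (Or F G))" if "set z \<subseteq> {..<5}" for z
      using that G(2)[of "z @ text_block f (k + 1) F"] by simp
    then show ?thesis
      using G(1) by (intro exI[of _ "text_block f (k + 1) F @ u"] exI[of _ v]) simp
  qed
qed

text \<open>A string that left one block for the next would contain the separator \<open>c\<close>.
  Nonemptiness of \<open>xs\<close> supplies a block for the empty string.\<close>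

lemma sublist_separated:
  assumes "c \<notin> set u" "xs \<noteq> []" "sublist u (concat (map (\<lambda>x. c # b x) xs))"
  shows "\<exists>x \<in> set xs. sublist u (b x)"
  using assms(2,3)
proof (induction xs)
  case (Cons x xs)
  show ?case
  proof (cases "u = []")
    case False
    let ?rest = "concat (map (\<lambda>x. c # b x) xs)"
    have "\<not> prefix u (c # zs)" for zs
      using assms(1) False by (cases u) auto
    then have "sublist u (b x @ ?rest)"
      using Cons.prems by (simp add: sublist_Cons_right)
    then consider "sublist u (b x)" | "sublist u ?rest"
      | u1 u2 where "u = u1 @ u2" "suffix u1 (b x)" "prefix u2 ?rest"
      by (auto simp: sublist_append)
    then show ?thesis
    proof cases
      case 2
      then show ?thesis
        using Cons.IH False by (cases xs) auto
    next
      case 3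
      have "u2 = []"
        using 3 assms(1) by (cases u2; cases xs) auto
      then show ?thesis
        using 3 by auto
    qed simp
  qed auto
qed simp

text \<open>A leaf holds iff its symbol in the text equals its symbol in the pattern: the text shows 4 at the false
  leaves of the first half of the variables, the pattern asks for 4 at the false leaves of the second half, and
  both have 3 otherwise.\<close>

definition text_sym :: "nat \<Rightarrow> nat \<Rightarrow> nat \<Rightarrow> nat" where
  "text_sym H x e = 3 + of_bool (e div 2 - 2 < H \<and> odd (x div 2 ^ (e div 2 - 2)) = odd e)"

definition pattern_sym :: "nat \<Rightarrow> nat \<Rightarrow> nat \<Rightarrow> nat" where
  "pattern_sym H y e = 3 + of_bool (\<not> e div 2 - 2 < H \<and> odd (y div 2 ^ (e div 2 - 2 - H)) = odd e)"

definition assignment :: "nat \<Rightarrow> nat \<Rightarrow> nat \<Rightarrow> nat \<Rightarrow> bool" where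
  "assignment H x y i = (if i < H then odd (x div 2 ^ i) else odd (y div 2 ^ (i - H)))"

lemma text_sym_eq_pattern_sym:
  "text_sym H x e = pattern_sym H y e \<longleftrightarrow> leaf_holds (assignment H x y) e"
  by (auto simp: text_sym_def pattern_sym_def assignment_def)

text \<open>The numbers below \<open>2 ^ H\<close> run through all assignments of \<open>H\<close>
  variables. Splitting off the lowest bit shifts the assignment by one, hence the generalisation
  over it.\<close>

lemma ex_binary: "\<exists>x<2 ^ H :: nat. \<forall>i<H. odd (x div 2 ^ i) \<longleftrightarrow> \<alpha> i"
proof (induction H arbitrary: \<alpha>)
  case (Suc H)
  obtain x :: nat where x: "x < 2 ^ H" "\<forall>i<H. odd (x div 2 ^ i) \<longleftrightarrow> \<alpha> (Suc i)"
    using Suc.IH[of "\<lambda>i. \<alpha> (Suc i)"] by auto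
  have "odd ((2 * x + of_bool (\<alpha> 0)) div 2 ^ i) \<longleftrightarrow> \<alpha> i" if "i < Suc H" for i
    using x(2) that by (cases i) (auto simp: div_mult2_eq)
  moreover have "2 * x + of_bool (\<alpha> 0) < 2 ^ Suc H"
    using x(1) by auto
  ultimately show ?case
    by blast
qed simp

text \<open>The separator 5 occurs neither in a block nor in a string matched by an alternative for
  some \<open>y\<close>.\<close>

definition full_text :: "nat \<Rightarrow> nat \<Rightarrow> formula \<Rightarrow> nat list" where
  "full_text H k F = concat (map (\<lambda>x. 5 # text_block (text_sym H x) k F) [0..<2 ^ H])"

text \<open>The symbol 6 does not occur in the text.\<close>

definition full_pattern :: "nat \<Rightarrow> nat \<Rightarrow> formula \<Rightarrow> nat rexp" where
  "full_pattern H k F = foldr Union (map (\<lambda>y. pattern (pattern_sym H y) k F) [0..<2 ^ H]) (Sym 6)"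

lemma lang_foldr_Union: "lang (foldr Union rs r) = \<Union> (lang ` set rs) \<union> lang r"
  by (induction rs) auto

lemma text_sym_bounds: "3 \<le> text_sym H x e" "text_sym H x e < 5"
  by (auto simp: text_sym_def)

lemma pattern_sym_bounds: "3 \<le> pattern_sym H x e" "pattern_sym H x e < 5"
  by (auto simp: pattern_sym_def)

lemma set_full_text: "set (full_text H k F) \<subseteq> {..<6}"
  unfolding full_text_def using set_text_block[OF text_sym_bounds(2)] by fastforce

lemma set_full_pattern: "set_rexp (full_pattern H k F) \<subseteq> {..<7}"
proof -
  have "set_rexp (foldr Union rs r) = \<Union> (set_rexp ` set rs) \<union> set_rexp r" for rs and r :: "nat rexp"
    by (induction rs) auto
  then show ?thesis
    unfolding full_pattern_def using set_rexp_pattern[OF pattern_sym_bounds(2)] by fastforce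
qed

text \<open>A match selects an alternative \<open>y\<close> and, having no separator in it, a block
  \<open>x\<close>; together these are an assignment of all variables. Conversely, a satisfying
  assignment is cut into its halves \<open>x\<close> and \<open>y\<close>.\<close>

lemma reduction_correct:
  assumes "fvars F \<subseteq> {..<2 * H}"
  shows "(\<exists>u. sublist u (full_text H k F) \<and> u \<in> lang (full_pattern H k F)) \<longleftrightarrow> satisfiable F"
proof
  assume "\<exists>u. sublist u (full_text H k F) \<and> u \<in> lang (full_pattern H k F)"
  then obtain u where u: "sublist u (full_text H k F)" and "u \<in> lang (full_pattern H k F)"
    by blast
  \<comment> \<open>This excludes the dummy alternative that ends the union.\<close>
  moreover have "u \<noteq> [6]"
    using set_mono_sublist[OF u] set_full_text[of H k F] by auto
  ultimately obtain y where y: "u \<in> lang (pattern (pattern_sym H y) k F)"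
    by (auto simp: full_pattern_def lang_foldr_Union)
  have "set u \<subseteq> {..<5}"
    using lang_set_rexp[OF y] set_rexp_pattern[of "pattern_sym H y", OF pattern_sym_bounds(2)] by blast
  then obtain x where x: "sublist u (text_block (text_sym H x) k F)"
    using sublist_separated[of 5 u "[0..<2 ^ H]" "\<lambda>x. text_block (text_sym H x) k F"] u
    unfolding full_text_def by (metis lessThan_iff less_irrefl subsetD upt_eq_Nil_conv zero_less_numeral zero_less_power not_le le_zero_eq)
  have "holds (assignment H x y) F"
  proof (rule pattern_sound[OF _ _ y])
    show "\<exists>e. (k', e) \<in> set (enumerate k (layout F)) \<and> v = text_sym H x e"
      if "3 \<le> v" "sublist (leaf_word v k') u" for k' v
      using leaf_word_sublist_text_block[OF that(1)] that(2) x sublist_order.order_trans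
      unfolding text_block_def by blast
  qed (auto simp: pattern_sym_bounds text_sym_eq_pattern_sym in_set_enumerate_eq simp del: leaf_holds.simps)
  then show "satisfiable F"
    by (auto simp: satisfiable_def)
next
  assume "satisfiable F"
  then obtain \<alpha> where \<alpha>: "holds \<alpha> F"
    by (auto simp: satisfiable_def)
  obtain x :: nat where x: "x < 2 ^ H" "\<forall>i<H. odd (x div 2 ^ i) \<longleftrightarrow> \<alpha> i"
    using ex_binary by blast
  obtain y :: nat where y: "y < 2 ^ H" "\<forall>i<H. odd (y div 2 ^ i) \<longleftrightarrow> \<alpha> (H + i)"
    using ex_binary[of H "\<lambda>i. \<alpha> (H + i)"] by blast
  have "assignment H x y i = \<alpha> i" if "i < 2 * H" for i
    using x(2) y(2)[rule_format, of "i - H"] that by (auto simp: assignment_def)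
  then have val: "text_sym H x e = pattern_sym H y e" if "leaf_holds \<alpha> e" "e div 2 - 2 \<in> {..<2 * H}" for e
    using that unfolding text_sym_eq_pattern_sym by (simp del: One_nat_def)
  have "\<exists>u v. text_block (text_sym H x) k F = u @ v \<and>
      (\<forall>z. set z \<subseteq> {..<5} \<longrightarrow> z @ u \<in> lang (pattern (pattern_sym H y) k F))"
    by (rule pattern_complete[OF text_sym_bounds(2) _ \<alpha> assms]) (rule val)
  then obtain u v where uv: "text_block (text_sym H x) k F = u @ v"
    and u: "\<forall>z. set z \<subseteq> {..<5} \<longrightarrow> z @ u \<in> lang (pattern (pattern_sym H y) k F)"
    by blast
  have "u \<in> lang (full_pattern H k F)"
    using u[rule_format, of "[]"] y(1) by (auto simp: full_pattern_def lang_foldr_Union)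
  moreover have "sublist u (full_text H k F)"
  proof -
    obtain as bs where "[0..<2 ^ H] = as @ x # bs"
      using x(1) by (metis atLeastLessThan_iff in_set_conv_decomp set_upt zero_le)
    then have "full_text H k F
        = (concat (map (\<lambda>x. 5 # text_block (text_sym H x) k F) as) @ [5]) @ u @
          (v @ concat (map (\<lambda>x. 5 # text_block (text_sym H x) k F) bs))"
      by (simp add: full_text_def uv)
    then show ?thesis
      by (metis sublist_appendI)
  qed
  ultimately show "\<exists>u. sublist u (full_text H k F) \<and> u \<in> lang (full_pattern H k F)"
    by blast
qed


section \<open>The token string of the pattern\<close>

abbreviation rexp_code :: "nat rexp \<Rightarrow> nat list" where
  "rexp_code r \<equiv> map token_code (rexp_string r)"

text \<open>The constant part spells the starred \<open>any_rexp\<close> up to the code 3 of the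
  star. The concatenation is nested to the right, so each digit opens a bracket that is closed only
  after the terminator, with code 6; this takes a second pass over the digits.\<close>

definition leaf_code :: "nat \<Rightarrow> nat \<Rightarrow> nat list" where
  "leaf_code v k =
    [0, 0, 4, 2, 0, 5, 2, 0, 6, 2, 0, 7, 2, 8, 1, 1, 1, 1, 3, 0, v + 4] @
    concat (map (\<lambda>b. [0, b + 4]) (bin_digits k)) @ [6] @
    concat (map (\<lambda>b. [1]) (bin_digits k)) @ [1, 1]"

definition pattern_entry :: "(nat \<Rightarrow> nat) \<Rightarrow> nat \<times> nat \<Rightarrow> nat list" where
  "pattern_entry g = (\<lambda>(k, e). if e < 4 then [e] else leaf_code (g e) k)"

lemma map_const_append_Cons: "map (\<lambda>_. a) xs @ a # ys = a # map (\<lambda>_. a) xs @ ys"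
  by (induction xs) auto

lemma rexp_code_foldr_Sym:
  "rexp_code (foldr Conc (map Sym w) r)
    = concat (map (\<lambda>c. [0, c + 4]) w) @ rexp_code r @ concat (map (\<lambda>c. [1]) w)"
  by (induction w) (simp_all add: map_const_append_Cons)

lemma rexp_code_leaf_rexp: "rexp_code (leaf_rexp v k) = leaf_code v k"
  unfolding leaf_rexp_def rexp_string.simps map_append rexp_code_foldr_Sym
  by (simp add: leaf_code_def any_rexp_def map_const_append_Cons)

text \<open>The layout already contains the brackets and bars of the printed expression, so one pass
  over it prints the pattern without a stack.\<close>

lemma rexp_code_pattern:
  "rexp_code (pattern g k F) = concat (map (pattern_entry g) (enumerate k (layout F)))"
  by (induction F arbitrary: k)
    (simp_all add: rexp_code_leaf_rexp pattern_entry_def enumerate_append_eq)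

text \<open>The union is nested to the right, so its closing brackets gather at the end.\<close>

lemma rexp_code_foldr_Union:
  "rexp_code (foldr Union rs r)
    = concat (map (\<lambda>r. 0 # rexp_code r @ [2]) rs) @ rexp_code r @ replicate (length rs) 1"
  by (induction rs) (simp_all add: replicate_append_same)

lemma rexp_code_full_pattern:
  "rexp_code (full_pattern H k F)
    = concat (map (\<lambda>y. 0 # concat (map (pattern_entry (pattern_sym H y)) (enumerate k (layout F))) @ [2])
        [0..<2 ^ H]) @ 10 # replicate (2 ^ H) 1"
  by (simp add: full_pattern_def rexp_code_foldr_Union rexp_code_pattern comp_def del: foldr_map)


section \<open>Timed Hoare triples\<close>

text \<open>Total correctness: halting is part of the claim, and \<open>T\<close> is an upper bound
  that may be rounded up.\<close>

definition triple :: "nat \<Rightarrow> (state \<Rightarrow> bool) \<Rightarrow> program \<Rightarrow> nat \<Rightarrow> (state \<Rightarrow> bool) \<Rightarrow> bool" where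
  "triple w A P T B \<longleftrightarrow> (\<forall>st. A st \<longrightarrow> (\<exists>T' st'. T' \<le> T \<and> exec w P st T' st' \<and> B st'))"

lemma triple_conseq:
  assumes "triple w A P T B" "\<And>st. A' st \<Longrightarrow> A st" "\<And>st. B st \<Longrightarrow> B' st" "T \<le> T'"
  shows "triple w A' P T' B'"
  using assms unfolding triple_def by (meson order_trans)

lemma triple_Seq:
  assumes "triple w A P T1 B" "triple w B Q T2 C"
  shows "triple w A (Seq P Q) (T1 + T2) C"
  using assms unfolding triple_def by (meson add_mono exec.Seq)

lemma triple_If_True:
  assumes "triple w A P T B" "\<And>st. A st \<Longrightarrow> expr_val w st e \<noteq> 0"
  shows "triple w A (If e P Q) (1 + expr_time e + T) B"
  using assms unfolding triple_def by (meson add_left_mono exec.IfTrue)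

lemma triple_If_False:
  assumes "triple w A Q T B" "\<And>st. A st \<Longrightarrow> expr_val w st e = 0"
  shows "triple w A (If e P Q) (1 + expr_time e + T) B"
  using assms unfolding triple_def by (meson add_left_mono exec.IfFalse)

text \<open>The two loop rules unfold a single test or round; each loop is then treated by an
  induction of its own.\<close>

lemma triple_While_exit:
  assumes "\<And>st. A st \<Longrightarrow> expr_val w st e = 0"
  shows "triple w A (While e P) (1 + expr_time e) A"
  using assms unfolding triple_def by (meson exec.WhileFalse order_refl)

lemma triple_While_step:
  assumes "triple w A P T1 B" "triple w B (While e P) T2 C" "\<And>st. A st \<Longrightarrow> expr_val w st e \<noteq> 0"
  shows "triple w A (While e P) (1 + expr_time e + T1 + T2) C"
  using assms unfolding triple_def by (meson add_mono order_refl exec.WhileTrue)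

section \<open>Loop-free programs by symbolic execution\<close>

fun loop_free :: "program \<Rightarrow> bool" where
  "loop_free (Seq P Q) = (loop_free P \<and> loop_free Q)"
| "loop_free (If e P Q) = (loop_free P \<and> loop_free Q)"
| "loop_free (While e P) = False"
| "loop_free _ = True"

text \<open>A functional semantics lets the simplifier execute a program. The value on loops is a
  default that \<open>loop_free\<close> excludes.\<close>

fun run :: "nat \<Rightarrow> program \<Rightarrow> state \<Rightarrow> state" where
  "run w (Assign r e) st = ((fst st)(r := expr_val w st e), snd st)"
| "run w (Store d e) st = (fst st, (snd st)(expr_val w st d := expr_val w st e))"
| "run w (Seq P Q) st = run w Q (run w P st)"
| "run w (If e P Q) st = (if expr_val w st e \<noteq> 0 then run w P st else run w Q st)"
| "run w _ st = st"

fun max_time :: "program \<Rightarrow> nat" where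
  "max_time Skip = 1"
| "max_time (Assign r e) = 1 + expr_time e"
| "max_time (Store d e) = 1 + expr_time d + expr_time e"
| "max_time (Seq P Q) = max_time P + max_time Q"
| "max_time (If e P Q) = 1 + expr_time e + max (max_time P) (max_time Q)"
| "max_time (While e P) = 0"

lemma exec_run: "loop_free P \<Longrightarrow> \<exists>T \<le> max_time P. exec w P st T (run w P st)"
proof (induction P arbitrary: st)
  case Skip
  show ?case
    using exec.Skip[of w st] by auto
next
  case (Assign r e)
  show ?case
    using exec.Assign[of w r e "fst st" "snd st"] by auto
next
  case (Store d e)
  show ?case
    using exec.Store[of w d e "fst st" "snd st"] by auto
next
  case (Seq P Q)
  obtain T1 where "T1 \<le> max_time P" "exec w P st T1 (run w P st)"
    using Seq.IH(1)[of st] Seq.prems by auto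
  moreover obtain T2 where "T2 \<le> max_time Q" "exec w Q (run w P st) T2 (run w Q (run w P st))"
    using Seq.IH(2)[of "run w P st"] Seq.prems by auto
  ultimately show ?case
    by (auto intro!: exI[of _ "T1 + T2"] exec.Seq)
next
  case (If e P Q)
  obtain T1 where T1: "T1 \<le> max_time P" "exec w P st T1 (run w P st)"
    using If.IH(1)[of st] If.prems by auto
  obtain T2 where T2: "T2 \<le> max_time Q" "exec w Q st T2 (run w Q st)"
    using If.IH(2)[of st] If.prems by auto
  show ?case
  proof (cases "expr_val w st e = 0")
    case True
    then have "exec w (If e P Q) st (1 + expr_time e + T2) (run w (If e P Q) st)"
      using exec.IfFalse T2(2) by simp
    then show ?thesis
      using T2(1) by (intro exI[of _ "1 + expr_time e + T2"]) simp
  next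
    case False
    then have "exec w (If e P Q) st (1 + expr_time e + T1) (run w (If e P Q) st)"
      using exec.IfTrue T1(2) by simp
    then show ?thesis
      using T1(1) by (intro exI[of _ "1 + expr_time e + T1"]) simp
  qed
qed simp

lemma triple_loop_free:
  assumes "loop_free P" "\<And>st. A st \<Longrightarrow> B (run w P st)" "max_time P \<le> T"
  shows "triple w A P T B"
  using exec_run[OF assms(1)] assms(2,3) unfolding triple_def by (meson order_trans)


section \<open>Programs that append to the memory\<close>

text \<open>Register 2 points to the first free cell of the memory.\<close>

definition holds_list :: "nat list \<Rightarrow> state \<Rightarrow> bool" where
  "holds_list L st \<longleftrightarrow> fst st 2 = length L \<and> (\<forall>i<length L. snd st i = L ! i)"

text \<open>The registers in \<open>S\<close> are protected and have the values
  \<open>\<rho>\<close>. Apart from register 2, other registers are scratch, and so is the memory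
  beyond \<open>L\<close>.\<close>

definition ctx :: "nat set \<Rightarrow> (nat \<Rightarrow> nat) \<Rightarrow> nat list \<Rightarrow> state \<Rightarrow> bool" where
  "ctx S \<rho> L st \<longleftrightarrow> holds_list L st \<and> (\<forall>r\<in>S. fst st r = \<rho> r)"

text \<open>Room for the output is assumed inside the definition, so composed programs need the
  overflow condition only once, for their total output.\<close>

definition emits :: "nat \<Rightarrow> nat set \<Rightarrow> (nat \<Rightarrow> nat) \<Rightarrow> nat list \<Rightarrow> program \<Rightarrow> nat \<Rightarrow> nat list \<Rightarrow> bool" where
  "emits w S \<rho> L P T xs \<longleftrightarrow>
    (length L + length xs < 2 ^ w \<longrightarrow> triple w (ctx S \<rho> L) P T (ctx S \<rho> (L @ xs)))"

lemma emits_Seq: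
  assumes "emits w S \<rho> L P T1 xs" "emits w S \<rho> (L @ xs) Q T2 ys"
  shows "emits w S \<rho> L (Seq P Q) (T1 + T2) (xs @ ys)"
  using assms triple_Seq unfolding emits_def by fastforce

lemma emits_time_mono: "emits w S \<rho> L P T xs \<Longrightarrow> T \<le> T' \<Longrightarrow> emits w S \<rho> L P T' xs"
  unfolding emits_def using triple_conseq by blast

lemma emits_Skip: "emits w S \<rho> L Skip 1 []"
  unfolding emits_def by (auto intro: triple_loop_free)

lemma emits_If_True:
  assumes "emits w S \<rho> L P T xs" "\<And>st. ctx S \<rho> L st \<Longrightarrow> expr_val w st e \<noteq> 0"
  shows "emits w S \<rho> L (If e P Q) (1 + expr_time e + T) xs"
  using assms unfolding emits_def by (meson triple_If_True)

lemma emits_If_False: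
  assumes "emits w S \<rho> L Q T xs" "\<And>st. ctx S \<rho> L st \<Longrightarrow> expr_val w st e = 0"
  shows "emits w S \<rho> L (If e P Q) (1 + expr_time e + T) xs"
  using assms unfolding emits_def by (meson triple_If_False)

lemma ctx_Assign:
  assumes "r \<noteq> 2" "\<And>st. ctx S \<rho> L st \<Longrightarrow> expr_val w st e = v"
  shows "triple w (ctx S \<rho> L) (Assign r e) (1 + expr_time e) (ctx (insert r S) (\<rho>(r := v)) L)"
proof (rule triple_loop_free)
  fix st assume *: "ctx S \<rho> L st"
  then have "expr_val w st e = v"
    using assms(2) by (cases st) auto
  then show "ctx (insert r S) (\<rho>(r := v)) L (run w (Assign r e) st)"
    using * assms(1) by (auto simp: ctx_def holds_list_def)
qed auto

lemma ctx_forget: "ctx (insert r S) (\<rho>(r := v)) L st \<Longrightarrow> r \<notin> S \<Longrightarrow> ctx S \<rho> L st"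
  by (auto simp: ctx_def)

text \<open>A register outside \<open>S\<close> acts as a local variable: it is tracked while
  \<open>P\<close> runs and forgotten afterwards.\<close>

lemma emits_Assign:
  assumes "r \<notin> S" "r \<noteq> 2" "\<And>st. ctx S \<rho> L st \<Longrightarrow> expr_val w st e = v"
    and "emits w (insert r S) (\<rho>(r := v)) L P T xs"
  shows "emits w S \<rho> L (Seq (Assign r e) P) (1 + expr_time e + T) xs"
  unfolding emits_def
proof
  assume *: "length L + length xs < 2 ^ w"
  show "triple w (ctx S \<rho> L) (Seq (Assign r e) P) (1 + expr_time e + T) (ctx S \<rho> (L @ xs))"
  proof (rule triple_conseq[OF triple_Seq])
    show "triple w (ctx S \<rho> L) (Assign r e) (1 + expr_time e) (ctx (insert r S) (\<rho>(r := v)) L)"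
      using assms(2,3) by (rule ctx_Assign)
    show "triple w (ctx (insert r S) (\<rho>(r := v)) L) P T (ctx (insert r S) (\<rho>(r := v)) (L @ xs))"
      using assms(4) * by (simp add: emits_def)
  qed (use ctx_forget[OF _ assms(1)] in auto)
qed

definition put :: "expr \<Rightarrow> program" where
  "put e = Seq (Store (Reg 2) e) (Assign 2 (Op Add (Reg 2) (Const 1)))"

fun puts :: "expr list \<Rightarrow> program" where
  "puts [] = Skip"
| "puts (e # es) = Seq (put e) (puts es)"

lemma holds_list_put:
  assumes "holds_list L st" "length L + 1 < 2 ^ w"
  shows "holds_list (L @ [expr_val w st e]) (run w (put e) st)"
  using assms by (cases "w = 0") (auto simp: holds_list_def put_def nth_append)

lemma emits_put:
  assumes "2 \<notin> S" "\<And>st. ctx S \<rho> L st \<Longrightarrow> expr_val w st e = x"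
  shows "emits w S \<rho> L (put e) (6 + expr_time e) [x]"
  unfolding emits_def
proof (intro impI triple_loop_free)
  fix st assume *: "length L + length [x] < 2 ^ w" "ctx S \<rho> L st"
  have "expr_val w st e = x"
    using assms(2) * by auto
  then have "holds_list (L @ [x]) (run w (put e) st)"
    using holds_list_put[of L st w e] * by (simp add: ctx_def)
  moreover have "fst (run w (put e) st) r = fst st r" if "r \<in> S" for r
    using assms(1) that by (auto simp: put_def)
  ultimately show "ctx S \<rho> (L @ [x]) (run w (put e) st)"
    using *(2) by (simp add: ctx_def)
qed (auto simp: put_def)

lemma emits_puts:
  assumes "2 \<notin> S" "\<And>st L. ctx S \<rho> L st \<Longrightarrow> map (expr_val w st) es = xs"
  shows "emits w S \<rho> L (puts es) (1 + (\<Sum>e\<leftarrow>es. 6 + expr_time e)) xs"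
  using assms(2)
proof (induction es arbitrary: L xs)
  case Nil
  then show ?case
    unfolding emits_def by (auto intro!: triple_loop_free)
next
  case (Cons e es)
  show ?case
  \<comment> \<open>Any state in the context shows that \<open>xs\<close> has the right shape;
    without such a state the triple is vacuous.\<close>
  proof (cases "\<exists>st L. ctx S \<rho> L st")
    case True
    then obtain x ys where xs: "xs = x # ys"
      using Cons.prems by fastforce
    have "emits w S \<rho> L (put e) (6 + expr_time e) [x]"
      using Cons.prems xs by (intro emits_put assms(1)) fastforce
    moreover have "emits w S \<rho> (L @ [x]) (puts es) (1 + (\<Sum>e\<leftarrow>es. 6 + expr_time e)) ys"
      using Cons.prems xs by (intro Cons.IH) fastforce
    ultimately have "emits w S \<rho> L (puts (e # es))
        ((6 + expr_time e) + (1 + (\<Sum>e\<leftarrow>es. 6 + expr_time e))) ([x] @ ys)"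
      unfolding puts.simps by (rule emits_Seq)
    then show ?thesis
      using xs by (auto elim: emits_time_mono)
  next
    case False
    then show ?thesis
      by (auto simp: emits_def triple_def)
  qed
qed

section \<open>Loops over counters and over binary digits\<close>

definition for_loop :: "nat \<Rightarrow> expr \<Rightarrow> nat \<Rightarrow> program \<Rightarrow> program" where
  "for_loop r e c P = Seq (Assign r e)
    (While (Op Less (Reg r) (Reg c)) (Seq P (Assign r (Op Add (Reg r) (Const 1)))))"

text \<open>A round costs the body plus 4 steps for the test and 4 for the increment, which cannot
  overflow below \<open>\<rho> c\<close>; the failing test costs 4. The body is considered on
  extensions of \<open>L\<close> only, so it may read what was written before the loop.\<close>

lemma emits_for_loop:
  assumes "r \<notin> S" "r \<noteq> 2" "c \<in> S" "\<rho> c < 2 ^ w" "a \<le> \<rho> c" "0 < w"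
    and start: "\<And>st. ctx S \<rho> L st \<Longrightarrow> expr_val w st e = a"
    and body: "\<And>k L'. a \<le> k \<Longrightarrow> k < \<rho> c \<Longrightarrow> prefix L L' \<Longrightarrow>
      emits w (insert r S) (\<rho>(r := k)) L' P T (g k)"
  shows "emits w S \<rho> L (for_loop r e c P)
    (1 + expr_time e + ((\<rho> c - a) * (T + 8) + 4)) (concat (map g [a..<\<rho> c]))"
proof -
  let ?loop = "While (Op Less (Reg r) (Reg c)) (Seq P (Assign r (Op Add (Reg r) (Const 1))))"
  have rc: "r \<noteq> c"
    using assms(1,3) by auto
  have loop: "triple w (ctx (insert r S) (\<rho>(r := k)) L') ?loop ((\<rho> c - k) * (T + 8) + 4)
      (ctx S \<rho> (L' @ concat (map g [k..<\<rho> c])))"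
    if "a \<le> k" "k \<le> \<rho> c" "prefix L L'" "length L' + length (concat (map g [k..<\<rho> c])) < 2 ^ w" for k L'
    using that
  proof (induction "\<rho> c - k" arbitrary: k L')
    case 0
    then have k: "k = \<rho> c"
      by simp
    have "triple w (ctx (insert r S) (\<rho>(r := k)) L') ?loop (1 + expr_time (Op Less (Reg r) (Reg c)))
      (ctx (insert r S) (\<rho>(r := k)) L')"
      using assms(3) rc k by (intro triple_While_exit) (auto simp: ctx_def)
    then show ?case
      by (rule triple_conseq) (use k in \<open>auto dest!: ctx_forget[OF _ assms(1)] simp del: fun_upd_apply\<close>)
  next
    case (Suc d)
    then have k: "k < \<rho> c"
      by simp
    then have upt: "[k..<\<rho> c] = k # [Suc k..<\<rho> c]"
      by (rule upt_conv_Cons)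
    have "triple w (ctx (insert r S) (\<rho>(r := k)) L') P T (ctx (insert r S) (\<rho>(r := k)) (L' @ g k))"
      using body[OF Suc.prems(1) k Suc.prems(3)] Suc.prems(4) by (simp add: emits_def upt)
    moreover have "triple w (ctx (insert r S) (\<rho>(r := k)) (L' @ g k)) (Assign r (Op Add (Reg r) (Const 1)))
        (1 + expr_time (Op Add (Reg r) (Const 1)))
        (ctx (insert r (insert r S)) ((\<rho>(r := k))(r := Suc k)) (L' @ g k))"
    proof (rule ctx_Assign[OF assms(2)])
      fix st assume "ctx (insert r S) (\<rho>(r := k)) (L' @ g k) st"
      then have "fst st r = k"
        by (simp add: ctx_def)
      moreover have "Suc k < 2 ^ w"
        using k assms(4) by simp
      ultimately show "expr_val w st (Op Add (Reg r) (Const 1)) = Suc k"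
        by (cases w) auto
    qed
    ultimately have "triple w (ctx (insert r S) (\<rho>(r := k)) L') (Seq P (Assign r (Op Add (Reg r) (Const 1))))
        (T + (1 + expr_time (Op Add (Reg r) (Const 1)))) (ctx (insert r S) (\<rho>(r := Suc k)) (L' @ g k))"
      using triple_Seq by fastforce
    moreover have "triple w (ctx (insert r S) (\<rho>(r := Suc k)) (L' @ g k)) ?loop ((\<rho> c - Suc k) * (T + 8) + 4)
        (ctx S \<rho> ((L' @ g k) @ concat (map g [Suc k..<\<rho> c])))"
      using Suc.hyps(2) Suc.prems k by (intro Suc.hyps(1)) (auto simp: upt)
    ultimately have "triple w (ctx (insert r S) (\<rho>(r := k)) L') ?loop
        (1 + expr_time (Op Less (Reg r) (Reg c)) + (T + (1 + expr_time (Op Add (Reg r) (Const 1))))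
          + ((\<rho> c - Suc k) * (T + 8) + 4)) (ctx S \<rho> ((L' @ g k) @ concat (map g [Suc k..<\<rho> c])))"
      using assms(3,4,6) k rc by (intro triple_While_step) (auto simp: ctx_def)
    moreover have "\<rho> c - k = Suc (\<rho> c - Suc k)"
      using k by simp
    ultimately show ?case
      by - (rule triple_conseq, assumption, simp_all add: upt del: fun_upd_apply)
  qed
  show ?thesis
    unfolding emits_def for_loop_def
    using triple_Seq[OF ctx_Assign[OF assms(2) start] loop[of a L]] assms(5) by auto
qed

text \<open>The shifts act on a copy, because register 10 is needed again for a second pass and as
  the counter of the surrounding loop.\<close>

definition digit_loop :: "program \<Rightarrow> program" where
  "digit_loop P = Seq (Assign 13 (Reg 10))
    (While (Reg 13) (Seq P (Assign 13 (Op Shr (Reg 13) (Const 1)))))"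

text \<open>The loop follows the recursion of \<open>bin_digits\<close>, which therefore guides the
  induction. A digit costs the body, 2 steps for the test and 4 for the shift.\<close>

lemma emits_digit_loop:
  assumes "13 \<notin> S" "10 \<in> S" "\<rho> 10 = k" "0 < w"
    and body: "\<And>j L. emits w (insert 13 S) (\<rho>(13 := j)) L P T (f (j mod 2))"
  shows "emits w S \<rho> L (digit_loop P)
    (4 + length (bin_digits k) * (T + 6)) (concat (map f (bin_digits k)))"
proof -
  let ?loop = "While (Reg 13) (Seq P (Assign 13 (Op Shr (Reg 13) (Const 1))))"
  have loop: "triple w (ctx (insert 13 S) (\<rho>(13 := j)) L) ?loop (2 + length (bin_digits j) * (T + 6))
      (ctx S \<rho> (L @ concat (map f (bin_digits j))))"
    if "length L + length (concat (map f (bin_digits j))) < 2 ^ w" for j L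
    using that
  proof (induction j arbitrary: L rule: bin_digits.induct)
    case (1 j)
    show ?case
    proof (cases "j = 0")
      case True
      have "triple w (ctx (insert 13 S) (\<rho>(13 := j)) L) ?loop (1 + expr_time (Reg 13))
        (ctx (insert 13 S) (\<rho>(13 := j)) L)"
        using True by (intro triple_While_exit) (auto simp: ctx_def)
      then show ?thesis
        by (rule triple_conseq) (use True in \<open>auto dest!: ctx_forget[OF _ assms(1)] simp del: fun_upd_apply\<close>)
    next
      case False
      then have digits: "bin_digits j = j mod 2 # bin_digits (j div 2)"
        by (simp add: bin_digits_pos)
      let ?L = "L @ f (j mod 2)"
      have "triple w (ctx (insert 13 S) (\<rho>(13 := j)) L) P T (ctx (insert 13 S) (\<rho>(13 := j)) ?L)"
        using body[of j L] "1.prems" by (simp add: emits_def digits)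
      moreover have "triple w (ctx (insert 13 S) (\<rho>(13 := j)) ?L) (Assign 13 (Op Shr (Reg 13) (Const 1)))
          (1 + expr_time (Op Shr (Reg 13) (Const 1)))
          (ctx (insert 13 (insert 13 S)) ((\<rho>(13 := j))(13 := j div 2)) ?L)"
        using assms(4) by (intro ctx_Assign) (auto simp: ctx_def)
      ultimately have "triple w (ctx (insert 13 S) (\<rho>(13 := j)) L) (Seq P (Assign 13 (Op Shr (Reg 13) (Const 1))))
          (T + (1 + expr_time (Op Shr (Reg 13) (Const 1)))) (ctx (insert 13 S) (\<rho>(13 := j div 2)) ?L)"
        using triple_Seq by fastforce
      moreover have "triple w (ctx (insert 13 S) (\<rho>(13 := j div 2)) ?L) ?loop
          (2 + length (bin_digits (j div 2)) * (T + 6)) (ctx S \<rho> (?L @ concat (map f (bin_digits (j div 2)))))"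
        using "1.prems" False by (intro "1.IH") (auto simp: digits)
      ultimately have "triple w (ctx (insert 13 S) (\<rho>(13 := j)) L) ?loop
          (1 + expr_time (Reg 13) + (T + (1 + expr_time (Op Shr (Reg 13) (Const 1))))
            + (2 + length (bin_digits (j div 2)) * (T + 6)))
          (ctx S \<rho> (?L @ concat (map f (bin_digits (j div 2)))))"
        using False by (intro triple_While_step) (auto simp: ctx_def)
      then show ?thesis
        by (rule triple_conseq) (simp_all add: digits del: fun_upd_apply)
    qed
  qed
  have start: "expr_val w st (Reg 10) = k" if "ctx S \<rho> L st" for st
    using that assms(2,3) by (auto simp: ctx_def)
  show ?thesis
    unfolding emits_def digit_loop_def
  proof
    assume *: "length L + length (concat (map f (bin_digits k))) < 2 ^ w"
    show "triple w (ctx S \<rho> L) (Seq (Assign 13 (Reg 10)) ?loop) (4 + length (bin_digits k) * (T + 6))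
        (ctx S \<rho> (L @ concat (map f (bin_digits k))))"
      using triple_Seq[OF ctx_Assign[OF _ start] loop[OF *]] by (rule triple_conseq) auto
  qed
qed


section \<open>Printing text and pattern from the layout\<close>

text \<open>All constants in the programs are below 16, so words that can hold 16 values leave them
  intact.\<close>

lemma mod_word: "16 \<le> (2::nat) ^ w \<Longrightarrow> k < 16 \<Longrightarrow> k mod 2 ^ w = k" for k :: nat
  by simp

lemma word_pos: "16 \<le> (2::nat) ^ w \<Longrightarrow> 0 < w"
  by (cases w) auto

text \<open>Without a borrow, wrapping subtraction is subtraction of natural numbers.\<close>

lemma binop_val_Sub:
  assumes "b \<le> a" "a < 2 ^ w"
  shows "binop_val w Sub a b = a - b"
proof -
  have "int a < 2 ^ w"
    using assms(2) by (metis of_nat_less_iff of_nat_numeral of_nat_power)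
  then have "int a - int b < 2 ^ w"
    by linarith
  then have "(int a - int b) mod 2 ^ w = int a - int b"
    using assms(1) by (intro mod_pos_pos_trivial) auto
  then show ?thesis
    using assms(1) by simp
qed

lemma binop_val_BitAnd_1: "binop_val w BitAnd a (Suc 0) = a mod 2"
  using and_one_eq[of a] by simp

lemma binop_val_BitAnd_0: "binop_val w BitAnd a 0 = 0"
  by simp

lemma binop_val_BitAnd_of_bool: "binop_val w BitAnd (of_bool P) (of_bool Q) = of_bool (P \<and> Q)"
  by auto

lemma of_bool_mod_word: "16 \<le> (2::nat) ^ w \<Longrightarrow> of_bool P mod 2 ^ w = (of_bool P :: nat)"
  by (cases w) auto

lemma mod_2_eq_iff: "a mod 2 = b mod 2 \<longleftrightarrow> odd a = odd b" for a b :: nat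
  by presburger

text \<open>Register 7 holds \<open>H\<close>, 8 holds \<open>2 ^ H\<close>, 9 the current assignment of one half, 10 the address of the current entry
  of the layout (which is also the number of the leaf), 11 the entry, 12 its symbol, and 13 the remaining digits of the
  number.\<close>

definition var_index :: expr where
  "var_index = Op Sub (Op Shr (Reg 11) (Const 1)) (Const 2)"

lemma var_index_val:
  assumes "16 \<le> (2::nat) ^ w" "fst st 11 = e" "4 \<le> e" "e < 2 ^ w"
  shows "expr_val w st var_index = e div 2 - 2"
proof -
  have "binop_val w Sub (e div 2) 2 = e div 2 - 2"
    using assms by (intro binop_val_Sub) auto
  then show ?thesis
    using assms mod_word[OF assms(1), of 2] word_pos[OF assms(1)]
    by (simp add: var_index_def del: binop_val.simps(2))
qed

definition text_sym_expr :: expr where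
  "text_sym_expr = Op Add (Const 3) (Op BitAnd (Op Less var_index (Reg 7))
    (Op Eq (Op BitAnd (Op Shr (Reg 9) var_index) (Const 1)) (Op BitAnd (Reg 11) (Const 1))))"

text \<open>The comparison with 0 serves as negation.\<close>

definition pattern_sym_expr :: expr where
  "pattern_sym_expr = Op Add (Const 3) (Op BitAnd (Op Eq (Op Less var_index (Reg 7)) (Const 0))
    (Op Eq (Op BitAnd (Op Shr (Reg 9) (Op Sub var_index (Reg 7))) (Const 1)) (Op BitAnd (Reg 11) (Const 1))))"

lemma text_sym_expr_val:
  assumes "16 \<le> (2::nat) ^ w" "fst st 11 = e" "4 \<le> e" "e < 2 ^ w"
  shows "expr_val w st text_sym_expr = text_sym (fst st 7) (fst st 9) e"
  using assms word_pos[OF assms(1)]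
  by (simp add: text_sym_expr_def text_sym_def var_index_val mod_word binop_val_BitAnd_1
      binop_val_BitAnd_of_bool of_bool_mod_word mod_2_eq_iff del: binop_val.simps(2,3))

lemma pattern_sym_expr_val:
  assumes "16 \<le> (2::nat) ^ w" "fst st 11 = e" "4 \<le> e" "e < 2 ^ w"
  shows "expr_val w st pattern_sym_expr = pattern_sym (fst st 7) (fst st 9) e"
proof -
  \<comment> \<open>For a variable of the first half this subtraction wraps around; its meaningless
    result is then masked by a conjunction with 0.\<close>
  have sub: "binop_val w Sub (e div 2 - 2) (fst st 7) = e div 2 - 2 - fst st 7"
    if "\<not> e div 2 - 2 < fst st 7"
    using that assms(4) by (intro binop_val_Sub) auto
  show ?thesis
    using assms word_pos[OF assms(1)]
    by (cases "e div 2 - 2 < fst st 7")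
      (simp_all add: pattern_sym_expr_def pattern_sym_def var_index_val mod_word binop_val_BitAnd_1
        binop_val_BitAnd_of_bool of_bool_mod_word mod_2_eq_iff binop_val_BitAnd_0 sub del: binop_val.simps(2,3))
qed

definition text_leaf :: program where
  "text_leaf = Seq (Assign 12 text_sym_expr) (Seq (puts [Reg 12])
    (Seq (digit_loop (puts [Op BitAnd (Reg 13) (Const 1)])) (puts [Const 2])))"

definition pattern_leaf :: program where
  "pattern_leaf = Seq (Assign 12 pattern_sym_expr)
    (Seq (puts (map Const [0, 0, 4, 2, 0, 5, 2, 0, 6, 2, 0, 7, 2, 8, 1, 1, 1, 1, 3, 0] @ [Op Add (Reg 12) (Const 4)]))
    (Seq (digit_loop (puts [Const 0, Op Add (Op BitAnd (Reg 13) (Const 1)) (Const 4)]))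
    (Seq (puts [Const 6])
    (Seq (digit_loop (puts [Const 1])) (puts [Const 1, Const 1])))))"

text \<open>The constants are round upper estimates; what matters is that the time is linear in the
  number of digits.\<close>

lemma emits_text_leaf:
  assumes w: "16 \<le> (2::nat) ^ w" and S: "{7, 9, 10, 11} \<subseteq> S" "S \<inter> {2, 12, 13} = {}"
    and \<rho>: "\<rho> 10 = k" "\<rho> 11 = e" and e: "4 \<le> e" "e < 2 ^ w"
  shows "emits w S \<rho> L text_leaf (100 + 100 * length (bin_digits k))
    (leaf_word (text_sym (\<rho> 7) (\<rho> 9) e) k)"
proof -
  let ?v = "text_sym (\<rho> 7) (\<rho> 9) e"
  let ?S = "insert 12 S" and ?\<rho> = "\<rho>(12 := ?v)"
  have digits: "emits w ?S ?\<rho> L (digit_loop (puts [Op BitAnd (Reg 13) (Const 1)]))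
      (4 + length (bin_digits k) * (10 + 6)) (concat (map (\<lambda>b. [b]) (bin_digits k)))" for L
  proof (rule emits_digit_loop)
    show "emits w (insert 13 ?S) (?\<rho>(13 := j)) L (puts [Op BitAnd (Reg 13) (Const 1)]) 10 [j mod 2]" for j L
      by (rule emits_time_mono[OF emits_puts])
        (use S w word_pos[OF w] in \<open>auto simp: ctx_def mod_word binop_val_BitAnd_1 simp del: binop_val.simps(3)\<close>)
  qed (use S \<rho> w word_pos in auto)
  have "emits w ?S ?\<rho> L (puts [Reg 12]) (1 + (\<Sum>e\<leftarrow>[Reg 12]. 6 + expr_time e)) [?v]" for L
    by (rule emits_puts) (use S in \<open>auto simp: ctx_def\<close>)
  moreover have "emits w ?S ?\<rho> L (puts [Const 2]) (1 + (\<Sum>e\<leftarrow>[Const 2]. 6 + expr_time e)) [2]" for L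
    by (rule emits_puts) (use S w word_pos[OF w] in \<open>auto simp: mod_word\<close>)
  ultimately have body: "emits w ?S ?\<rho> L (Seq (puts [Reg 12])
      (Seq (digit_loop (puts [Op BitAnd (Reg 13) (Const 1)])) (puts [Const 2])))
      (1 + (\<Sum>e\<leftarrow>[Reg 12]. 6 + expr_time e) + (4 + length (bin_digits k) * (10 + 6)
        + (1 + (\<Sum>e\<leftarrow>[Const 2]. 6 + expr_time e))))
      ([?v] @ concat (map (\<lambda>b. [b]) (bin_digits k)) @ [2])"
    by (intro emits_Seq digits)
  have "expr_val w st text_sym_expr = ?v" if "ctx S \<rho> L st" for st
    using text_sym_expr_val[OF w _ e, of st] that S \<rho> by (auto simp: ctx_def)
  from emits_Assign[OF _ _ this body] show ?thesis
    unfolding text_leaf_def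
    using S by (auto simp: leaf_word_def text_sym_expr_def var_index_def elim!: emits_time_mono)
qed

lemma emits_pattern_leaf:
  assumes w: "16 \<le> (2::nat) ^ w" and S: "{7, 9, 10, 11} \<subseteq> S" "S \<inter> {2, 12, 13} = {}"
    and \<rho>: "\<rho> 10 = k" "\<rho> 11 = e" and e: "4 \<le> e" "e < 2 ^ w"
  shows "emits w S \<rho> L pattern_leaf (400 + 100 * length (bin_digits k))
    (leaf_code (pattern_sym (\<rho> 7) (\<rho> 9) e) k)"
proof -
  let ?v = "pattern_sym (\<rho> 7) (\<rho> 9) e"
  let ?S = "insert 12 S" and ?\<rho> = "\<rho>(12 := ?v)"
  let ?cs = "[0, 0, 4, 2, 0, 5, 2, 0, 6, 2, 0, 7, 2, 8, 1, 1, 1, 1, 3, 0]"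
  have digits: "emits w ?S ?\<rho> L (digit_loop (puts [Const 0, Op Add (Op BitAnd (Reg 13) (Const 1)) (Const 4)]))
      (4 + length (bin_digits k) * (20 + 6)) (concat (map (\<lambda>b. [0, b + 4]) (bin_digits k)))" for L
  proof (rule emits_digit_loop)
    show "emits w (insert 13 ?S) (?\<rho>(13 := j)) L
        (puts [Const 0, Op Add (Op BitAnd (Reg 13) (Const 1)) (Const 4)]) 20 [0, j mod 2 + 4]" for j L
      by (rule emits_time_mono[OF emits_puts])
        (use S w word_pos[OF w] in \<open>auto simp: ctx_def mod_word binop_val_BitAnd_1 simp del: binop_val.simps(3)\<close>)
  qed (use S \<rho> w word_pos in auto)
  have rpar: "emits w ?S ?\<rho> L (digit_loop (puts [Const 1]))
      (4 + length (bin_digits k) * (8 + 6)) (concat (map (\<lambda>b. [1]) (bin_digits k)))" for L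
  proof (rule emits_digit_loop)
    show "emits w (insert 13 ?S) (?\<rho>(13 := j)) L (puts [Const 1]) 8 [1]" for j L
      by (rule emits_time_mono[OF emits_puts]) (use S w word_pos[OF w] in \<open>auto simp: mod_word\<close>)
  qed (use S \<rho> w word_pos in auto)
  have "emits w ?S ?\<rho> L (puts (map Const ?cs @ [Op Add (Reg 12) (Const 4)])) 200 (?cs @ [?v + 4])" for L
    by (rule emits_time_mono[OF emits_puts])
      (use S w word_pos[OF w] pattern_sym_bounds(2)[of "\<rho> 7" "\<rho> 9" e] in \<open>auto simp: mod_word ctx_def\<close>)
  moreover have "emits w ?S ?\<rho> L (puts [Const 6]) 10 [6]" for L
    by (rule emits_time_mono[OF emits_puts]) (use S w word_pos[OF w] in \<open>auto simp: mod_word\<close>)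
  moreover have "emits w ?S ?\<rho> L (puts [Const 1, Const 1]) 20 [1, 1]" for L
    by (rule emits_time_mono[OF emits_puts]) (use S w word_pos[OF w] in \<open>auto simp: mod_word\<close>)
  ultimately have body: "emits w ?S ?\<rho> L
    (Seq (puts (map Const ?cs @ [Op Add (Reg 12) (Const 4)]))
    (Seq (digit_loop (puts [Const 0, Op Add (Op BitAnd (Reg 13) (Const 1)) (Const 4)]))
    (Seq (puts [Const 6])
    (Seq (digit_loop (puts [Const 1])) (puts [Const 1, Const 1])))))
      (200 + (4 + length (bin_digits k) * (20 + 6) + (10 + (4 + length (bin_digits k) * (8 + 6) + 20))))
      ((?cs @ [?v + 4]) @ concat (map (\<lambda>b. [0, b + 4]) (bin_digits k)) @ [6] @
        concat (map (\<lambda>b. [1]) (bin_digits k)) @ [1, 1])"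
    by (intro emits_Seq digits rpar)
  have "expr_val w st pattern_sym_expr = ?v" if "ctx S \<rho> L st" for st
    using pattern_sym_expr_val[OF w _ e, of st] that S \<rho> by (auto simp: ctx_def)
  from emits_Assign[OF _ _ this body] have "emits w S \<rho> L pattern_leaf
      (1 + expr_time pattern_sym_expr +
        (200 + (4 + length (bin_digits k) * (20 + 6) + (10 + (4 + length (bin_digits k) * (8 + 6) + 20)))))
      (leaf_code ?v k)"
    unfolding pattern_leaf_def leaf_code_def using S by (simp only: append_assoc append.simps) auto
  then show ?thesis
    by (rule emits_time_mono) (simp add: pattern_sym_expr_def var_index_def)
qed

text \<open>The layout occupies the cells from the address in register 0 up to the address in register 14.\<close>

definition block_loop :: "program \<Rightarrow> program \<Rightarrow> program" where
  "block_loop P Q = for_loop 10 (Reg 0) 14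
    (Seq (Assign 11 (Mem (Reg 10))) (If (Op Less (Reg 11) (Const 4)) P Q))"

text \<open>Numbers become addresses: with the input \<open>xs\<close> in front of the layout
  \<open>ys\<close>, the entry numbered \<open>k\<close> is cell \<open>k\<close>.\<close>

lemma enumerate_conv_nth:
  "enumerate (length xs) ys = map (\<lambda>k. (k, (xs @ ys) ! k)) [length xs..<length (xs @ ys)]"
  by (rule nth_equalityI) (auto simp: nth_enumerate_eq nth_append)

lemma emits_block_loop:
  assumes w: "16 \<le> (2::nat) ^ w" and S: "{0, 14} \<subseteq> S" "S \<inter> {2, 10, 11} = {}"
    and \<rho>: "\<rho> 0 = length xs" "\<rho> 14 = length (xs @ ys)" "length (xs @ ys) < 2 ^ w" and L: "prefix (xs @ ys) L"
    and P: "\<And>k e L. e \<in> set ys \<Longrightarrow> e < 4 \<Longrightarrow>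
      emits w (insert 11 (insert 10 S)) (\<rho>(10 := k, 11 := e)) L P T (f k e)"
    and Q: "\<And>k e L. e \<in> set ys \<Longrightarrow> 4 \<le> e \<Longrightarrow> k < length (xs @ ys) \<Longrightarrow>
      emits w (insert 11 (insert 10 S)) (\<rho>(10 := k, 11 := e)) L Q T (g k e)"
  shows "emits w S \<rho> L (block_loop P Q) (10 + length ys * (T + 20))
    (concat (map (\<lambda>(k, e). if e < 4 then f k e else g k e) (enumerate (length xs) ys)))"
proof -
  let ?h = "\<lambda>(k, e). if e < 4 then f k e else g k e"
  have "emits w S \<rho> L (block_loop P Q) (1 + expr_time (Reg 0) + ((\<rho> 14 - length xs) * ((T + 7) + 8) + 4))
      (concat (map (\<lambda>k. ?h (k, (xs @ ys) ! k)) [length xs..<\<rho> 14]))"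
    unfolding block_loop_def
  proof (rule emits_for_loop)
    fix k L' assume k: "length xs \<le> k" "k < \<rho> 14" and L': "prefix L L'"
    define e where "e = (xs @ ys) ! k"
    \<comment> \<open>Output is only appended, so the layout can still be read at its old
      addresses.\<close>
    have "prefix (xs @ ys) L'"
      using L L' by simp
    then have e_eq: "L' ! k = e" and k': "k < length L'"
      using k(2) \<rho>(2) by (auto simp: e_def prefix_def nth_append)
    have e: "e \<in> set ys"
      using k \<rho>(2) by (auto simp: e_def nth_append)
    let ?S = "insert 10 S" and ?\<rho> = "\<rho>(10 := k)"
    have branch: "emits w (insert 11 ?S) (?\<rho>(11 := e)) L' (If (Op Less (Reg 11) (Const 4)) P Q)
        (1 + expr_time (Op Less (Reg 11) (Const 4)) + T) (?h (k, e))"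
    proof (cases "e < 4")
      case True
      have "emits w (insert 11 ?S) (?\<rho>(11 := e)) L' P T (?h (k, e))"
        using P[OF e True] True by simp
      then show ?thesis
        by (rule emits_If_True) (use True w word_pos[OF w] in \<open>auto simp: ctx_def mod_word\<close>)
    next
      case False
      have "emits w (insert 11 ?S) (?\<rho>(11 := e)) L' Q T (?h (k, e))"
        using Q[OF e] k \<rho> False by simp
      then show ?thesis
        by (rule emits_If_False) (use False w word_pos[OF w] in \<open>auto simp: ctx_def mod_word\<close>)
    qed
    have "emits w ?S ?\<rho> L' (Seq (Assign 11 (Mem (Reg 10))) (If (Op Less (Reg 11) (Const 4)) P Q))
        (1 + expr_time (Mem (Reg 10)) + (1 + expr_time (Op Less (Reg 11) (Const 4)) + T)) (?h (k, e))"
      using branch by (intro emits_Assign[where v = e])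
        (use S k' e_eq in \<open>auto simp: ctx_def holds_list_def\<close>)
    then show "emits w ?S ?\<rho> L' (Seq (Assign 11 (Mem (Reg 10))) (If (Op Less (Reg 11) (Const 4)) P Q))
        (T + 7) (?h (k, (xs @ ys) ! k))"
      unfolding e_def by (rule emits_time_mono) simp
  qed (use S \<rho> word_pos[OF w] in \<open>auto simp: ctx_def\<close>)
  then show ?thesis
    unfolding enumerate_conv_nth map_map comp_def using \<rho>(2)
    by (auto simp: algebra_simps elim!: emits_time_mono)
qed

section \<open>Outer loops over the assignments of one half\<close>

definition text_program :: program where
  "text_program = for_loop 9 (Const 0) 8 (Seq (puts [Const 5]) (block_loop Skip text_leaf))"

definition pattern_program :: program where
  "pattern_program = for_loop 9 (Const 0) 8
    (Seq (puts [Const 0]) (Seq (block_loop (puts [Reg 11]) pattern_leaf) (puts [Const 2])))"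

text \<open>Closes the brackets of the nested union, one for each assignment.\<close>

definition closing_program :: program where
  "closing_program = for_loop 9 (Const 0) 8 (puts [Const 1])"

text \<open>Addresses are bounded by the word size \<open>w\<close>, numbers of digits by
  \<open>D\<close>. Keeping the two apart makes the time independent of the word size.\<close>

lemma emits_text_program:
  assumes w: "16 \<le> (2::nat) ^ w" and S: "S = {0, 7, 8, 14}"
    and \<rho>: "\<rho> 0 = length xs" "\<rho> 14 = length (xs @ layout F)" "\<rho> 7 = H" "\<rho> 8 = 2 ^ H" "(2::nat) ^ H < 2 ^ w"
    and L: "prefix (xs @ layout F) L"
    and len: "length (xs @ layout F) < 2 ^ w" "length (xs @ layout F) < 2 ^ D"
    and small: "\<And>e. e \<in> set (layout F) \<Longrightarrow> e < 2 ^ w"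
  shows "emits w S \<rho> L text_program (10 + 2 ^ H * (50 + length (layout F) * (150 + 100 * D)))
    (full_text H (length xs) F)"
proof -
  have "emits w S \<rho> L text_program
      (1 + expr_time (Const 0) + ((\<rho> 8 - 0) * ((8 + (10 + length (layout F) * ((101 + 100 * D) + 20))) + 8) + 4))
      (concat (map (\<lambda>x. [5] @ text_block (text_sym H x) (length xs) F) [0..<\<rho> 8]))"
    unfolding text_program_def
  proof (rule emits_for_loop)
    fix x L' assume "prefix L L'"
    then have L': "prefix (xs @ layout F) (L' @ [5])"
      using L by (meson prefix_order.order_trans prefixI)
    let ?S = "insert 9 S" and ?\<rho> = "\<rho>(9 := x)"
    have sep: "emits w ?S ?\<rho> L' (puts [Const 5]) 8 [5]"
      by (rule emits_time_mono[OF emits_puts]) (use S w word_pos[OF w] in \<open>auto simp: mod_word\<close>)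
    have "emits w ?S ?\<rho> (L' @ [5]) (block_loop Skip text_leaf) (10 + length (layout F) * ((101 + 100 * D) + 20))
        (concat (map (\<lambda>(k, e). if e < 4 then [] else leaf_word (text_sym H x e) k)
          (enumerate (length xs) (layout F))))"
    proof (rule emits_block_loop[OF w _ _ _ _ len(1) L'])
      show "emits w (insert 11 (insert 10 ?S)) (?\<rho>(10 := k, 11 := e)) L Skip (101 + 100 * D) []" for k e L
        by (rule emits_time_mono[OF emits_Skip]) simp
      show "emits w (insert 11 (insert 10 ?S)) (?\<rho>(10 := k, 11 := e)) L text_leaf (101 + 100 * D)
          (leaf_word (text_sym H x e) k)"
        if "e \<in> set (layout F)" "4 \<le> e" "k < length (xs @ layout F)" for k e L
      proof -
        have "length (bin_digits k) \<le> D"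
          using that(3) len(2) by (intro length_bin_digits) simp
        moreover have "emits w (insert 11 (insert 10 ?S)) (?\<rho>(10 := k, 11 := e)) L text_leaf
            (100 + 100 * length (bin_digits k))
            (leaf_word (text_sym ((?\<rho>(10 := k, 11 := e)) 7) ((?\<rho>(10 := k, 11 := e)) 9) e) k)"
          using that small by (intro emits_text_leaf[OF w]) (auto simp: S)
        ultimately show ?thesis
          using \<rho> by (auto elim!: emits_time_mono)
      qed
    qed (use S \<rho> in auto)
    then have "emits w ?S ?\<rho> (L' @ [5]) (block_loop Skip text_leaf)
        (10 + length (layout F) * ((101 + 100 * D) + 20)) (text_block (text_sym H x) (length xs) F)"
      by (simp add: text_block_def text_entry_def)
    with sep show "emits w ?S ?\<rho> L' (Seq (puts [Const 5]) (block_loop Skip text_leaf))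
        (8 + (10 + length (layout F) * ((101 + 100 * D) + 20))) ([5] @ text_block (text_sym H x) (length xs) F)"
      by (rule emits_Seq)
  qed (use S \<rho> word_pos[OF w] in auto)
  then show ?thesis
    using \<rho>(4) by (auto simp: full_text_def algebra_simps elim!: emits_time_mono)
qed

lemma emits_pattern_program:
  assumes w: "16 \<le> (2::nat) ^ w" and S: "S = {0, 7, 8, 14}"
    and \<rho>: "\<rho> 0 = length xs" "\<rho> 14 = length (xs @ layout F)" "\<rho> 7 = H" "\<rho> 8 = 2 ^ H" "(2::nat) ^ H < 2 ^ w"
    and L: "prefix (xs @ layout F) L"
    and len: "length (xs @ layout F) < 2 ^ w" "length (xs @ layout F) < 2 ^ D"
    and small: "\<And>e. e \<in> set (layout F) \<Longrightarrow> e < 2 ^ w"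
  shows "emits w S \<rho> L (Seq pattern_program (Seq (puts [Const 10]) closing_program))
    (50 + 2 ^ H * (100 + length (layout F) * (450 + 100 * D)))
    (rexp_code (full_pattern H (length xs) F))"
proof -
  let ?block = "\<lambda>y. concat (map (pattern_entry (pattern_sym H y)) (enumerate (length xs) (layout F)))"
  let ?T = "10 + length (layout F) * ((400 + 100 * D) + 20)"
  have "emits w S \<rho> L pattern_program
      (1 + expr_time (Const 0) + ((\<rho> 8 - 0) * ((8 + (?T + 8)) + 8) + 4))
      (concat (map (\<lambda>y. [0] @ ?block y @ [2]) [0..<\<rho> 8]))"
    unfolding pattern_program_def
  proof (rule emits_for_loop)
    fix y L' assume "prefix L L'"
    then have L': "prefix (xs @ layout F) (L' @ [0])"
      using L by (meson prefix_order.order_trans prefixI)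
    let ?S = "insert 9 S" and ?\<rho> = "\<rho>(9 := y)"
    have lpar: "emits w ?S ?\<rho> L' (puts [Const 0]) 8 [0]"
      by (rule emits_time_mono[OF emits_puts]) (use S w word_pos[OF w] in \<open>auto simp: mod_word\<close>)
    have bar: "emits w ?S ?\<rho> L'' (puts [Const 2]) 8 [2]" for L''
      by (rule emits_time_mono[OF emits_puts]) (use S w word_pos[OF w] in \<open>auto simp: mod_word\<close>)
    have "emits w ?S ?\<rho> (L' @ [0]) (block_loop (puts [Reg 11]) pattern_leaf) ?T
        (concat (map (\<lambda>(k, e). if e < 4 then [e] else leaf_code (pattern_sym H y e) k)
          (enumerate (length xs) (layout F))))"
    proof (rule emits_block_loop[OF w _ _ _ _ len(1) L'])
      show "emits w (insert 11 (insert 10 ?S)) (?\<rho>(10 := k, 11 := e)) L (puts [Reg 11]) (400 + 100 * D) [e]" for k e L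
        by (rule emits_time_mono[OF emits_puts]) (use S in \<open>auto simp: ctx_def\<close>)
      show "emits w (insert 11 (insert 10 ?S)) (?\<rho>(10 := k, 11 := e)) L pattern_leaf (400 + 100 * D)
          (leaf_code (pattern_sym H y e) k)"
        if "e \<in> set (layout F)" "4 \<le> e" "k < length (xs @ layout F)" for k e L
      proof -
        have "length (bin_digits k) \<le> D"
          using that(3) len(2) by (intro length_bin_digits) simp
        moreover have "emits w (insert 11 (insert 10 ?S)) (?\<rho>(10 := k, 11 := e)) L pattern_leaf
            (400 + 100 * length (bin_digits k))
            (leaf_code (pattern_sym ((?\<rho>(10 := k, 11 := e)) 7) ((?\<rho>(10 := k, 11 := e)) 9) e) k)"
          using that small by (intro emits_pattern_leaf[OF w]) (auto simp: S)
        ultimately show ?thesis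
          using \<rho> by (auto elim!: emits_time_mono)
      qed
    qed (use S \<rho> in auto)
    then have "emits w ?S ?\<rho> (L' @ [0]) (block_loop (puts [Reg 11]) pattern_leaf) ?T (?block y)"
      by (simp add: pattern_entry_def)
    with lpar bar show "emits w ?S ?\<rho> L'
        (Seq (puts [Const 0]) (Seq (block_loop (puts [Reg 11]) pattern_leaf) (puts [Const 2])))
        (8 + (?T + 8)) ([0] @ ?block y @ [2])"
      by (intro emits_Seq)
  qed (use S \<rho> word_pos[OF w] in auto)
  moreover have "emits w S \<rho> L' (puts [Const 10]) 8 [10]" for L'
    by (rule emits_time_mono[OF emits_puts]) (use S w word_pos[OF w] in \<open>auto simp: mod_word\<close>)
  moreover have "emits w S \<rho> L' closing_program
      (1 + expr_time (Const 0) + ((\<rho> 8 - 0) * (8 + 8) + 4)) (concat (map (\<lambda>y. [1]) [0..<\<rho> 8]))" for L'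
    unfolding closing_program_def
  proof (rule emits_for_loop)
    show "emits w (insert 9 S) (\<rho>(9 := y)) L'' (puts [Const 1]) 8 [1]" for y L''
      by (rule emits_time_mono[OF emits_puts]) (use S w word_pos[OF w] in \<open>auto simp: mod_word\<close>)
  qed (use S \<rho> word_pos[OF w] in auto)
  ultimately have "emits w S \<rho> L (Seq pattern_program (Seq (puts [Const 10]) closing_program))
      (1 + expr_time (Const 0) + ((\<rho> 8 - 0) * ((8 + (?T + 8)) + 8) + 4) +
        (8 + (1 + expr_time (Const 0) + ((\<rho> 8 - 0) * (8 + 8) + 4))))
      (concat (map (\<lambda>y. [0] @ ?block y @ [2]) [0..<\<rho> 8]) @ [10] @ concat (map (\<lambda>y. [1]) [0..<\<rho> 8]))"
    by (intro emits_Seq)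
  moreover have "concat (map (\<lambda>y. [0] @ ?block y @ [2]) [0..<\<rho> 8]) @ [10] @ concat (map (\<lambda>y. [1]) [0..<\<rho> 8])
      = rexp_code (full_pattern H (length xs) F)"
    by (simp add: rexp_code_full_pattern \<rho>(4) map_replicate_const)
  ultimately show ?thesis
    using \<rho>(4) by (auto simp: algebra_simps elim!: emits_time_mono)
qed


section \<open>Computing the layout\<close>

text \<open>The stack grows upwards, with the head of the list on top at address \<open>a\<close>.
  The 0 below its last element is the end marker that stops the loop.\<close>

fun stack_at :: "(nat \<Rightarrow> nat) \<Rightarrow> nat \<Rightarrow> nat list \<Rightarrow> bool" where
  "stack_at M a [] = (M a = 0)"
| "stack_at M a (x # xs) = (M a = x \<and> stack_at M (a - 1) xs)"

lemma stack_at_above: "a < p \<Longrightarrow> stack_at (M(p := v)) a xs = stack_at M a xs"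
  by (induction xs arbitrary: a) auto

lemma stack_at_below: "p + length xs < a \<Longrightarrow> stack_at (M(p := v)) a xs = stack_at M a xs"
  by (induction xs arbitrary: a) auto

definition push :: "nat \<Rightarrow> program" where
  "push k = Seq (Assign 4 (Op Add (Reg 4) (Const 1))) (Store (Reg 4) (Const k))"

text \<open>The stack holds what is still to be written: the codes 1 and 2 of a right bracket and a bar, and 3 for the
  next unread formula.\<close>

definition layout_step :: program where
  "layout_step = Seq (Assign 5 (Mem (Reg 4))) (Seq (Assign 4 (Op Sub (Reg 4) (Const 1)))
    (If (Op Eq (Reg 5) (Const 3))
      (Seq (Assign 6 (Mem (Reg 3))) (Seq (Assign 3 (Op Add (Reg 3) (Const 1)))
        (If (Op Less (Reg 6) (Const 2))
          (Seq (put (Const 0)) (Seq (push 1) (Seq (push 3) (Seq (If (Reg 6) (push 2) Skip) (push 3)))))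
          (put (Op Add (Reg 6) (Const 2))))))
      (put (Reg 5))))"

definition layout_loop :: program where
  "layout_loop = While (Mem (Reg 4)) layout_step"

text \<open>The bottom of the stack is a zero at address \<open>4 * length inp\<close>, above the space for the layout.\<close>

definition layout_inv :: "nat list \<Rightarrow> nat \<Rightarrow> nat list \<Rightarrow> nat list \<Rightarrow> state \<Rightarrow> bool" where
  "layout_inv inp i xs out st \<longleftrightarrow> holds_list (inp @ out) st \<and> fst st 0 = length inp \<and> fst st 3 = i \<and>
    fst st 4 = 4 * length inp + length xs \<and> stack_at (snd st) (4 * length inp + length xs) xs"

lemma holds_list_upd: "length L \<le> p \<Longrightarrow> holds_list L (R, M(p := v)) = holds_list L (R, M)"
  by (auto simp: holds_list_def)

lemma holds_list_snoc: "holds_list L (R, M) \<Longrightarrow> holds_list (L @ [v]) (R(2 := Suc (length L)), M(length L := v))"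
  by (auto simp: holds_list_def nth_append)

lemma holds_list_reg: "r \<noteq> 2 \<Longrightarrow> holds_list L (R(r := v), M) = holds_list L (R, M)"
  by (auto simp: holds_list_def)

lemma layout_step_simps: "loop_free layout_step" "max_time layout_step \<le> 100"
  by (simp_all add: layout_step_def push_def put_def)

lemma layout_step_token:
  assumes w: "16 \<le> (2::nat) ^ w" and "a = 1 \<or> a = 2"
    and "4 * length inp + length xs + 1 < 2 ^ w" "length inp + length out < 4 * length inp"
  shows "triple w (layout_inv inp i (a # xs) out) layout_step 100 (layout_inv inp i xs (out @ [a]))"
proof (rule triple_loop_free[OF layout_step_simps(1) _ layout_step_simps(2)])
  fix st assume "layout_inv inp i (a # xs) out st"
  then obtain R M where st: "st = (R, M)" and hl: "holds_list (inp @ out) (R, M)"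
    and R: "R 0 = length inp" "R 3 = i" "R 4 = Suc (4 * length inp + length xs)" "R 2 = length inp + length out"
    and M: "M (Suc (4 * length inp + length xs)) = a" "stack_at M (4 * length inp + length xs) xs"
    by (cases st) (auto simp: layout_inv_def holds_list_def)
  have sub: "binop_val w Sub (Suc (4 * length inp + length xs)) (Suc 0) = 4 * length inp + length xs"
    using assms(3) by (subst binop_val_Sub) auto
  let ?R = "R(5 := a, 4 := 4 * length inp + length xs)"
  have "run w layout_step st = (?R(2 := Suc (length inp + length out)), M(length inp + length out := a))"
    using assms word_pos[OF w] R M sub
    by (auto simp: layout_step_def st put_def mod_word simp del: binop_val.simps(2))
  moreover have "holds_list (inp @ out @ [a]) (?R(2 := Suc (length inp + length out)), M(length inp + length out := a))"
    using holds_list_snoc[of "inp @ out" ?R M a] hl by (simp add: holds_list_reg)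
  \<comment> \<open>The output cell lies below the stack, so writing it leaves the stack
    alone.\<close>
  moreover have "stack_at (M(length inp + length out := a)) (4 * length inp + length xs) xs"
    using M(2) assms(4) by (subst stack_at_below) auto
  ultimately show "layout_inv inp i xs (out @ [a]) (run w layout_step st)"
    using R by (simp add: layout_inv_def)
qed

lemma layout_step_leaf:
  assumes w: "16 \<le> (2::nat) ^ w" and i: "i < length inp" "inp ! i = c" "2 \<le> c" "c + 2 < 2 ^ w"
    and "4 * length inp + length xs + 1 < 2 ^ w" "length inp + length out < 4 * length inp"
  shows "triple w (layout_inv inp i (3 # xs) out) layout_step 100 (layout_inv inp (Suc i) xs (out @ [c + 2]))"
proof (rule triple_loop_free[OF layout_step_simps(1) _ layout_step_simps(2)])
  fix st assume "layout_inv inp i (3 # xs) out st"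
  then obtain R M where st: "st = (R, M)" and hl: "holds_list (inp @ out) (R, M)"
    and R: "R 0 = length inp" "R 3 = i" "R 4 = Suc (4 * length inp + length xs)" "R 2 = length inp + length out"
    and M: "M (Suc (4 * length inp + length xs)) = 3" "stack_at M (4 * length inp + length xs) xs"
    by (cases st) (auto simp: layout_inv_def holds_list_def)
  have c: "M i = c"
    using hl i(1,2) by (simp add: holds_list_def nth_append)
  have sub: "binop_val w Sub (Suc (4 * length inp + length xs)) (Suc 0) = 4 * length inp + length xs"
    using assms(6) by (subst binop_val_Sub) auto
  let ?R = "R(5 := 3, 4 := 4 * length inp + length xs, 6 := c, 3 := Suc i)"
  have "run w layout_step st = (?R(2 := Suc (length inp + length out)), M(length inp + length out := c + 2))"
    using assms word_pos[OF w] R M sub c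
    by (auto simp: layout_step_def st put_def mod_word simp del: binop_val.simps(2))
  moreover have "holds_list (inp @ out @ [c + 2])
      (?R(2 := Suc (length inp + length out)), M(length inp + length out := c + 2))"
    using holds_list_snoc[of "inp @ out" ?R M "c + 2"] hl by (simp add: holds_list_reg)
  moreover have "stack_at (M(length inp + length out := c + 2)) (4 * length inp + length xs) xs"
    using M(2) assms(7) by (subst stack_at_below) auto
  ultimately show "layout_inv inp (Suc i) xs (out @ [c + 2]) (run w layout_step st)"
    using R by (simp add: layout_inv_def)
qed

text \<open>After the opening bracket, \<open>ys\<close> remains to be written: two formulas and a
  right bracket, with a bar between the formulas in a disjunction.\<close>

lemma layout_step_gate:
  assumes w: "16 \<le> (2::nat) ^ w" and i: "i < length inp" "inp ! i = c" "c < 2"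
    and "4 * length inp + length xs + 4 < 2 ^ w" "length inp + length out < 4 * length inp"
    and ys: "ys = (if c = 0 then [3, 3, 1] else [3, 2, 3, 1])"
  shows "triple w (layout_inv inp i (3 # xs) out) layout_step 100 (layout_inv inp (Suc i) (ys @ xs) (out @ [0]))"
proof (rule triple_loop_free[OF layout_step_simps(1) _ layout_step_simps(2)])
  fix st assume "layout_inv inp i (3 # xs) out st"
  then obtain R M where st: "st = (R, M)" and hl: "holds_list (inp @ out) (R, M)"
    and R: "R 0 = length inp" "R 3 = i" "R 4 = Suc (4 * length inp + length xs)" "R 2 = length inp + length out"
    and M: "M (Suc (4 * length inp + length xs)) = 3" "stack_at M (4 * length inp + length xs) xs"
    by (cases st) (auto simp: layout_inv_def holds_list_def)
  have c: "M i = c"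
    using hl i(1,2) by (simp add: holds_list_def nth_append)
  \<comment> \<open>The top of the stack after the pop; the pushes fill the cells directly
    above.\<close>
  define b where "b = 4 * length inp + length xs"
  have sub: "binop_val w Sub (Suc b) (Suc 0) = b"
    using assms(5) by (subst binop_val_Sub) (auto simp: b_def)
  have small: "Suc (length inp + length out) < 2 ^ w" "Suc i < 2 ^ w"
    using assms(2,5,6) by (simp_all add: b_def)
  let ?R = "R(5 := 3, 4 := b, 6 := c, 3 := Suc i)"
  let ?M = "M(length inp + length out := 0)"
  have "holds_list (inp @ out @ [0]) (?R(2 := Suc (length inp + length out)), ?M)"
    using holds_list_snoc[of "inp @ out" ?R M 0] hl by (simp add: holds_list_reg)
  then have hl': "holds_list (inp @ out @ [0]) (?R(2 := Suc (length inp + length out), 4 := a), ?M)" for a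
    by (subst holds_list_reg) auto
  have st': "stack_at ?M b xs"
    using M(2) assms(6) by (subst stack_at_below) (auto simp: b_def)
  consider "c = 0" | "c = 1"
    using i(3) by linarith
  then show "layout_inv inp (Suc i) (ys @ xs) (out @ [0]) (run w layout_step st)"
  proof cases
    case 1
    let ?R' = "?R(2 := Suc (length inp + length out), 4 := b + 3)"
    let ?M' = "?M(b + 1 := 1, b + 2 := 3, b + 3 := 3)"
    have "run w layout_step st = (?R', ?M')"
      using assms(1-6) word_pos[OF w] R M sub c 1 small
      by (auto simp: layout_step_def st put_def push_def mod_word b_def[symmetric] fun_upd_twist numeral_3_eq_3
          simp del: binop_val.simps(2))
    moreover have "holds_list (inp @ out @ [0]) (?R', ?M')"
      using hl'[of "b + 3"] assms(6) by (simp add: b_def holds_list_upd)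
    moreover have "stack_at ?M' (b + 3) (ys @ xs)"
      using 1 ys st' by (simp add: stack_at_above)
    ultimately show ?thesis
      using R 1 ys by (simp add: layout_inv_def b_def)
  next
    case 2
    let ?R' = "?R(2 := Suc (length inp + length out), 4 := b + 4)"
    let ?M' = "?M(b + 1 := 1, b + 2 := 3, b + 3 := 2, b + 4 := 3)"
    have "run w layout_step st = (?R', ?M')"
      using assms(1-6) word_pos[OF w] R M sub c 2 small
      by (auto simp: layout_step_def st put_def push_def mod_word b_def[symmetric] fun_upd_twist numeral_3_eq_3
          simp del: binop_val.simps(2))
    moreover have "holds_list (inp @ out @ [0]) (?R', ?M')"
      using hl'[of "b + 4"] assms(6) by (simp add: b_def holds_list_upd)
    moreover have "stack_at ?M' (b + 4) (ys @ xs)"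
      using 2 ys st' by (simp add: stack_at_above)
    ultimately show ?thesis
      using R 2 ys by (simp add: layout_inv_def b_def)
  qed
qed

text \<open>The loop test costs 3 steps, and it succeeds because stack entries are positive.\<close>

lemma layout_loop_step:
  assumes "triple w (layout_inv inp i (a # xs) out) layout_step 100 A" "0 < a"
    and "triple w A layout_loop T C"
  shows "triple w (layout_inv inp i (a # xs) out) layout_loop (103 + T) C"
proof -
  have "triple w (layout_inv inp i (a # xs) out) layout_loop (1 + expr_time (Mem (Reg 4)) + 100 + T) C"
    using assms unfolding layout_loop_def
    by (intro triple_While_step) (auto simp: layout_inv_def)
  then show ?thesis
    by simp
qed

lemma nth_drop_Cons: "drop i xs = y # ys \<Longrightarrow> i < length xs \<and> xs ! i = y \<and> drop (Suc i) xs = ys"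
  by (metis Cons_nth_drop_Suc drop_all linorder_not_le list.distinct(1) list.inject)

text \<open>Every round writes exactly one entry, which gives 103 steps per entry. The rest of the
  run is an arbitrary continuation, so that the recursion over the formula can be followed inside a
  single loop with an explicit stack.\<close>

lemma layout_loop_formula:
  assumes w: "16 \<le> (2::nat) ^ w" and inp: "\<And>c. c \<in> set inp \<Longrightarrow> c + 2 < 2 ^ w"
    and "drop i inp = formula_code F @ cs"
    and "length inp + length out + length (layout F) \<le> 4 * length inp"
    and "4 * length inp + length xs + 4 * leaves F < 2 ^ w"
    and "triple w (layout_inv inp (i + length (formula_code F)) xs (out @ layout F)) layout_loop T C"
  shows "triple w (layout_inv inp i (3 # xs) out) layout_loop (103 * length (layout F) + T) C"
  using assms(3-6)
proof (induction F arbitrary: i cs xs out T)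
  case (Pos j)
  have *: "i < length inp" "inp ! i = 2 * j + 2"
    using nth_drop_Cons[of i inp] Pos.prems(1) by auto
  have entry: "2 * j + 2 + 2 = 2 * j + 4"
    by simp
  have "triple w (layout_inv inp i (3 # xs) out) layout_step 100
      (layout_inv inp (Suc i) xs (out @ [2 * j + 2 + 2]))"
    using Pos.prems(2,3) inp[of "2 * j + 2"] * nth_mem[of i inp] by (intro layout_step_leaf[OF w]) auto
  from layout_loop_step[OF this[unfolded entry]] show ?case
    using Pos.prems(4) by simp
next
  case (Neg j)
  have *: "i < length inp" "inp ! i = 2 * j + 3"
    using nth_drop_Cons[of i inp] Neg.prems(1) by auto
  have entry: "2 * j + 3 + 2 = 2 * j + 5"
    by simp
  have "triple w (layout_inv inp i (3 # xs) out) layout_step 100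
      (layout_inv inp (Suc i) xs (out @ [2 * j + 3 + 2]))"
    using Neg.prems(2,3) inp[of "2 * j + 3"] * nth_mem[of i inp] by (intro layout_step_leaf[OF w]) auto
  from layout_loop_step[OF this[unfolded entry]] show ?case
    using Neg.prems(4) by simp
next
  case (And F G)
  let ?iF = "Suc i + length (formula_code F)"
  let ?i = "?iF + length (formula_code G)"
  have *: "i < length inp" "inp ! i = 0" "drop (Suc i) inp = formula_code F @ formula_code G @ cs"
    using nth_drop_Cons[of i inp] And.prems(1) by auto
  then have **: "drop ?iF inp = formula_code G @ cs"
    by (metis append_eq_conv_conj drop_drop add.commute)
  \<comment> \<open>The continuations are built from the end: closing bracket, right side, left
    side, and finally the gate.\<close>
  have "triple w (layout_inv inp ?i (1 # xs) (out @ 0 # layout F @ layout G)) layout_step 100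
      (layout_inv inp ?i xs ((out @ 0 # layout F @ layout G) @ [1]))"
    using And.prems(2,3) leaves_pos[of F] by (intro layout_step_token[OF w]) auto
  then have "triple w (layout_inv inp ?i (1 # xs) (out @ 0 # layout F @ layout G)) layout_loop (103 + T) C"
    by (rule layout_loop_step) (use And.prems(4) in \<open>auto simp: algebra_simps\<close>)
  then have "triple w (layout_inv inp ?i (1 # xs) ((out @ 0 # layout F) @ layout G)) layout_loop (103 + T) C"
    by simp
  then have "triple w (layout_inv inp ?iF (3 # 1 # xs) (out @ 0 # layout F)) layout_loop
      (103 * length (layout G) + (103 + T)) C"
    using ** And.prems(2,3) leaves_pos[of F] by (intro And.IH(2)) auto
  then have "triple w (layout_inv inp ?iF (3 # 1 # xs) ((out @ [0]) @ layout F)) layout_loop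
      (103 * length (layout G) + (103 + T)) C"
    by simp
  then have "triple w (layout_inv inp (Suc i) (3 # 3 # 1 # xs) (out @ [0])) layout_loop
      (103 * length (layout F) + (103 * length (layout G) + (103 + T))) C"
    using * And.prems(2,3) leaves_pos[of G] by (intro And.IH(1)) auto
  moreover have "triple w (layout_inv inp i (3 # xs) out) layout_step 100
      (layout_inv inp (Suc i) ([3, 3, 1] @ xs) (out @ [0]))"
    using And.prems(2,3) * leaves_pos[of F] leaves_pos[of G]
    by (intro layout_step_gate[OF w, where c = 0]) auto
  ultimately show ?case
    using layout_loop_step[of w inp i 3 xs out] by (fastforce elim: triple_conseq)
next
  case (Or F G)
  let ?iF = "Suc i + length (formula_code F)"
  let ?i = "?iF + length (formula_code G)"
  have *: "i < length inp" "inp ! i = 1" "drop (Suc i) inp = formula_code F @ formula_code G @ cs"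
    using nth_drop_Cons[of i inp] Or.prems(1) by auto
  then have **: "drop ?iF inp = formula_code G @ cs"
    by (metis append_eq_conv_conj drop_drop add.commute)
  have "triple w (layout_inv inp ?i (1 # xs) (out @ 0 # layout F @ 2 # layout G)) layout_step 100
      (layout_inv inp ?i xs ((out @ 0 # layout F @ 2 # layout G) @ [1]))"
    using Or.prems(2,3) leaves_pos[of F] by (intro layout_step_token[OF w]) auto
  then have "triple w (layout_inv inp ?i (1 # xs) (out @ 0 # layout F @ 2 # layout G)) layout_loop (103 + T) C"
    by (rule layout_loop_step) (use Or.prems(4) in \<open>auto simp: algebra_simps\<close>)
  then have "triple w (layout_inv inp ?i (1 # xs) ((out @ 0 # layout F @ [2]) @ layout G)) layout_loop (103 + T) C"
    by simp
  then have "triple w (layout_inv inp ?iF (3 # 1 # xs) (out @ 0 # layout F @ [2])) layout_loop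
      (103 * length (layout G) + (103 + T)) C"
    using ** Or.prems(2,3) leaves_pos[of F] by (intro Or.IH(2)) auto
  moreover have "triple w (layout_inv inp ?iF (2 # 3 # 1 # xs) (out @ 0 # layout F)) layout_step 100
      (layout_inv inp ?iF (3 # 1 # xs) ((out @ 0 # layout F) @ [2]))"
    using Or.prems(2,3) leaves_pos[of F] leaves_pos[of G] by (intro layout_step_token[OF w]) auto
  ultimately have "triple w (layout_inv inp ?iF (2 # 3 # 1 # xs) ((out @ [0]) @ layout F)) layout_loop
      (103 + (103 * length (layout G) + (103 + T))) C"
    using layout_loop_step by fastforce
  then have "triple w (layout_inv inp (Suc i) (3 # 2 # 3 # 1 # xs) (out @ [0])) layout_loop
      (103 * length (layout F) + (103 + (103 * length (layout G) + (103 + T)))) C"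
    using * Or.prems(2,3) leaves_pos[of G] by (intro Or.IH(1)) auto
  moreover have "triple w (layout_inv inp i (3 # xs) out) layout_step 100
      (layout_inv inp (Suc i) ([3, 2, 3, 1] @ xs) (out @ [0]))"
    using Or.prems(2,3) * leaves_pos[of F] leaves_pos[of G]
    by (intro layout_step_gate[OF w, where c = 1]) auto
  ultimately show ?case
    using layout_loop_step[of w inp i 3 xs out] by (fastforce elim: triple_conseq)
qed

text \<open>Reading starts at cell 1, as cell 0 holds \<open>n\<close>. Additions produce
  \<open>4 * length inp\<close>, the base of the stack, and the first entry 3 stands for the whole
  formula.\<close>

definition layout_program :: program where
  "layout_program = Seq (Seq (Assign 2 (Reg 0)) (Seq (Assign 3 (Const 1))
    (Seq (Assign 4 (Op Add (Op Add (Reg 0) (Reg 0)) (Op Add (Reg 0) (Reg 0)))) (push 3)))) layout_loop"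

lemma length_formula_code: "length (formula_code F) + 1 = 2 * leaves F"
  by (induction F) auto

text \<open>With \<open>s\<close> leaves, input and layout take less than \<open>6 * s\<close>
  cells, and the stack starts at \<open>8 * s\<close> and is allowed \<open>4 * s\<close> more;
  \<open>20 * s\<close> leaves slack.\<close>

lemma layout_program_correct:
  assumes w: "16 \<le> (2::nat) ^ w" and inp: "inp = input_code n F" "\<And>c. c \<in> set inp \<Longrightarrow> c + 2 < 2 ^ w"
    and size: "20 * leaves F < 2 ^ w"
  shows "triple w (\<lambda>st. st = initial_state inp) layout_program (50 + 103 * length (layout F))
    (ctx {0} (\<lambda>_. length inp) (inp @ layout F))"
proof -
  have len: "length inp = 2 * leaves F"
    using length_formula_code[of F] by (simp add: inp(1) input_code_def)
  have "triple w (layout_inv inp i [] (layout F)) layout_loop (1 + expr_time (Mem (Reg 4)))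
      (layout_inv inp i [] (layout F))" for i
    unfolding layout_loop_def by (rule triple_While_exit) (simp add: layout_inv_def)
  then have exit: "triple w (layout_inv inp i [] ([] @ layout F)) layout_loop 3
      (ctx {0} (\<lambda>_. length inp) (inp @ layout F))" for i
    by (rule triple_conseq) (auto simp: layout_inv_def ctx_def)
  have loop: "triple w (layout_inv inp 1 [3] []) layout_loop (103 * length (layout F) + 3)
      (ctx {0} (\<lambda>_. length inp) (inp @ layout F))"
  proof (rule layout_loop_formula[OF w inp(2) _ _ _ exit])
    show "drop 1 inp = formula_code F @ []"
      by (simp add: inp(1) input_code_def)
  qed (use len size length_layout[of F] in auto)
  have "triple w (\<lambda>st. st = initial_state inp)
      (Seq (Assign 2 (Reg 0)) (Seq (Assign 3 (Const 1))
        (Seq (Assign 4 (Op Add (Op Add (Reg 0) (Reg 0)) (Op Add (Reg 0) (Reg 0)))) (push 3)))) 40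
      (layout_inv inp 1 [3] [])"
    using w word_pos[OF w] len size leaves_pos[of F]
    by (intro triple_loop_free)
      (auto simp: push_def layout_inv_def holds_list_def initial_state_def mod_word)
  from triple_Seq[OF this loop] show ?thesis
    unfolding layout_program_def by (rule triple_conseq) auto
qed


section \<open>The whole program\<close>

text \<open>The output starts where the layout ends, at the address in register 14. The length of
  the text is known only after printing, so its cell is reserved with 0 and filled
  afterwards.\<close>

definition reduction_program :: program where
  "reduction_program = Seq layout_program
    (Seq (Assign 14 (Reg 2))
    (Seq (Assign 7 (Op Shr (Op Add (Mem (Const 0)) (Const 1)) (Const 1)))
    (Seq (Assign 8 (Op Shl (Const 1) (Reg 7)))
    (Seq (Seq (put (Const 0)) text_program)
    (Seq (Store (Reg 14) (Op Sub (Op Sub (Reg 2) (Reg 14)) (Const 1)))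
    (Seq (Seq pattern_program (Seq (puts [Const 10]) closing_program))
    (Seq (Assign 1 (Op Sub (Reg 2) (Reg 14))) (Assign 0 (Reg 14)))))))))"

lemma formula_code_le: "c \<in> set (formula_code F) \<Longrightarrow> fvars F \<subseteq> {..<n} \<Longrightarrow> c \<le> 2 * n + 1"
  by (induction F) auto

lemma layout_le: "e \<in> set (layout F) \<Longrightarrow> fvars F \<subseteq> {..<n} \<Longrightarrow> e \<le> 2 * n + 3"
  by (induction F) auto

lemma reduction_program_correct:
  fixes n F
  defines "inp \<equiv> input_code n F" and "H \<equiv> (n + 1) div 2"
  defines "k \<equiv> length inp"
  defines "t \<equiv> full_text H k F" and "p \<equiv> full_pattern H k F"
  assumes w: "16 \<le> (2::nat) ^ w" and F: "fvars F \<subseteq> {..<n}"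
    and n: "2 * n + 16 < 2 ^ w" "(2::nat) ^ H < 2 ^ w" and size: "20 * leaves F < 2 ^ w"
    and out: "k + length (layout F) + 1 + length t + length (rexp_code p) < 2 ^ w"
    and D: "k + length (layout F) < 2 ^ D"
  shows "computes_within w reduction_program inp (output_code t p)
    (300 + 103 * length (layout F) + 2 ^ H * (150 + length (layout F) * (600 + 200 * D)))"
proof -
  define L0 where "L0 = inp @ layout F"
  have inp_small: "c + 2 < 2 ^ w" if "c \<in> set inp" for c
    using that n(1) formula_code_le[OF _ F, of c] by (auto simp: inp_def input_code_def)
  have layout_small: "e < 2 ^ w" if "e \<in> set (layout F)" for e
    using layout_le[OF that F] n(1) by linarith
  have k_pos: "0 < k" and inp0: "inp ! 0 = n"
    by (simp_all add: k_def inp_def input_code_def)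
  have len0: "length L0 = k + length (layout F)"
    by (simp add: L0_def k_def)
  define \<rho>0 :: "nat \<Rightarrow> nat" where "\<rho>0 = (\<lambda>_. k)"
  define \<rho>1 where "\<rho>1 = \<rho>0(14 := length L0)"
  define \<rho>2 where "\<rho>2 = \<rho>1(7 := H)"
  define \<rho> where "\<rho> = \<rho>2(8 := 2 ^ H)"
  define S :: "nat set" where "S = {0, 7, 8, 14}"
  have p0: "triple w (\<lambda>st. st = initial_state inp) layout_program (50 + 103 * length (layout F)) (ctx {0} \<rho>0 L0)"
    using layout_program_correct[OF w meta_eq_to_obj_eq[OF inp_def] inp_small size] by (simp add: L0_def \<rho>0_def k_def inp_def)
  have p1: "triple w (ctx {0} \<rho>0 L0) (Assign 14 (Reg 2)) (1 + expr_time (Reg 2)) (ctx (insert 14 {0}) \<rho>1 L0)"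
    unfolding \<rho>1_def by (rule ctx_Assign) (auto simp: ctx_def holds_list_def)
  have p2: "triple w (ctx (insert 14 {0}) \<rho>1 L0) (Assign 7 (Op Shr (Op Add (Mem (Const 0)) (Const 1)) (Const 1)))
      (1 + expr_time (Op Shr (Op Add (Mem (Const 0)) (Const 1)) (Const 1))) (ctx (insert 7 (insert 14 {0})) \<rho>2 L0)"
    unfolding \<rho>2_def
  proof (rule ctx_Assign)
    fix st assume "ctx (insert 14 {0}) \<rho>1 L0 st"
    then have "snd st 0 = n"
      using k_pos inp0 by (auto simp: ctx_def holds_list_def L0_def k_def nth_append)
    then show "expr_val w st (Op Shr (Op Add (Mem (Const 0)) (Const 1)) (Const 1)) = H"
      using n(1) word_pos[OF w] by (simp add: H_def)
  qed simp
  have p3: "triple w (ctx (insert 7 (insert 14 {0})) \<rho>2 L0) (Assign 8 (Op Shl (Const 1) (Reg 7)))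
      (1 + expr_time (Op Shl (Const 1) (Reg 7))) (ctx (insert 8 (insert 7 (insert 14 {0}))) \<rho> L0)"
    unfolding \<rho>_def
    by (rule ctx_Assign) (use n(2) word_pos[OF w] in \<open>auto simp: ctx_def \<rho>2_def\<close>)
  have S_eq: "insert 8 (insert 7 (insert 14 {0})) = S"
    by (auto simp: S_def)
  have \<rho>: "\<rho> 0 = length inp" "\<rho> 14 = length (inp @ layout F)" "\<rho> 7 = H" "\<rho> 8 = 2 ^ H"
    by (simp_all add: \<rho>_def \<rho>2_def \<rho>1_def \<rho>0_def L0_def k_def)
  have len1: "length (inp @ layout F) < 2 ^ w" "length (inp @ layout F) < 2 ^ D"
    using out D by (simp_all add: k_def)
  have "emits w S \<rho> L0 (put (Const 0)) (6 + expr_time (Const 0)) [0]"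
    by (rule emits_put) (auto simp: S_def)
  moreover have "emits w S \<rho> (L0 @ [0]) text_program (10 + 2 ^ H * (50 + length (layout F) * (150 + 100 * D))) t"
    unfolding t_def k_def
    using emits_text_program[OF w S_def \<rho> n(2) _ len1 layout_small, of "L0 @ [0]"] by (simp add: L0_def)
  ultimately have "emits w S \<rho> L0 (Seq (put (Const 0)) text_program)
      (6 + expr_time (Const 0) + (10 + 2 ^ H * (50 + length (layout F) * (150 + 100 * D)))) ([0] @ t)"
    by (rule emits_Seq)
  then have p4: "triple w (ctx S \<rho> L0) (Seq (put (Const 0)) text_program)
      (6 + expr_time (Const 0) + (10 + 2 ^ H * (50 + length (layout F) * (150 + 100 * D))))
      (ctx S \<rho> (L0 @ [0] @ t))"
    using out len0 by (simp add: emits_def)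
  let ?L = "L0 @ [length t] @ t"
  have p5: "triple w (ctx S \<rho> (L0 @ [0] @ t)) (Store (Reg 14) (Op Sub (Op Sub (Reg 2) (Reg 14)) (Const 1))) 10 (ctx S \<rho> ?L)"
  proof (rule triple_loop_free)
    fix st assume st: "ctx S \<rho> (L0 @ [0] @ t) st"
    have R: "fst st 14 = length L0" "fst st 2 = length L0 + 1 + length t"
      using st by (auto simp: ctx_def S_def \<rho> holds_list_def L0_def)
    \<comment> \<open>The difference counts the reserved cell too, hence the further subtraction of
      1.\<close>
    have "binop_val w Sub (length L0 + 1 + length t) (length L0) = length t + 1"
      using out len0 by (subst binop_val_Sub) auto
    moreover have "binop_val w Sub (length t + 1) 1 = length t"
      using out by (subst binop_val_Sub) auto
    ultimately have "expr_val w st (Op Sub (Op Sub (Reg 2) (Reg 14)) (Const 1)) = length t"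
      using R word_pos[OF w] by (simp del: binop_val.simps(2))
    then show "ctx S \<rho> ?L (run w (Store (Reg 14) (Op Sub (Op Sub (Reg 2) (Reg 14)) (Const 1))) st)"
      using st R by (auto simp: ctx_def holds_list_def nth_append nth_Cons' simp del: expr_val.simps(4))
  qed auto
  have "emits w S \<rho> ?L (Seq pattern_program (Seq (puts [Const 10]) closing_program))
      (50 + 2 ^ H * (100 + length (layout F) * (450 + 100 * D))) (rexp_code p)"
    unfolding p_def k_def
    using emits_pattern_program[OF w S_def \<rho> n(2) _ len1 layout_small, of ?L] by (simp add: L0_def)
  then have p6: "triple w (ctx S \<rho> ?L) (Seq pattern_program (Seq (puts [Const 10]) closing_program))
      (50 + 2 ^ H * (100 + length (layout F) * (450 + 100 * D))) (ctx S \<rho> (?L @ rexp_code p))"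
    using out len0 by (simp add: emits_def)
  let ?ys = "output_code t p"
  have L_out: "?L @ rexp_code p = L0 @ ?ys"
    by (simp add: output_code_def)
  define fin where "fin = (\<lambda>st :: state. fst st 0 = length L0 \<and> fst st 1 = length ?ys \<and>
    (\<forall>i < length L0 + length ?ys. snd st i = (L0 @ ?ys) ! i))"
  have len_out: "length L0 + length ?ys < 2 ^ w"
    using out len0 by (simp add: output_code_def)
  have p7: "triple w (ctx S \<rho> (?L @ rexp_code p)) (Seq (Assign 1 (Op Sub (Reg 2) (Reg 14))) (Assign 0 (Reg 14))) 10 fin"
    unfolding L_out
  proof (rule triple_loop_free)
    fix st assume st: "ctx S \<rho> (L0 @ ?ys) st"
    have R: "fst st 14 = length L0" "fst st 2 = length L0 + length ?ys"
      using st by (auto simp: ctx_def S_def \<rho> holds_list_def L0_def)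
    have "binop_val w Sub (length L0 + length ?ys) (length L0) = length ?ys"
      using len_out by (subst binop_val_Sub) auto
    then have "expr_val w st (Op Sub (Reg 2) (Reg 14)) = length ?ys"
      using R by simp
    then show "fin (run w (Seq (Assign 1 (Op Sub (Reg 2) (Reg 14))) (Assign 0 (Reg 14))) st)"
      using st R by (simp add: fin_def ctx_def holds_list_def del: expr_val.simps(4))
  qed auto
  note all = triple_Seq[OF p0 triple_Seq[OF p1 triple_Seq[OF p2 triple_Seq[OF p3[unfolded S_eq]
    triple_Seq[OF p4 triple_Seq[OF p5 triple_Seq[OF p6 p7]]]]]]]
  have "triple w (\<lambda>st. st = initial_state inp) reduction_program
      (300 + 103 * length (layout F) + 2 ^ H * (150 + length (layout F) * (600 + 200 * D))) fin"
    unfolding reduction_program_def by (rule triple_conseq[OF all]) (simp_all add: algebra_simps)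
  then obtain T' R M where run: "exec w reduction_program (initial_state inp) T' (R, M)" "fin (R, M)"
    and T': "T' \<le> 300 + 103 * length (layout F) + 2 ^ H * (150 + length (layout F) * (600 + 200 * D))"
    unfolding triple_def by force
  have "map M [R 0..<R 0 + R 1] = ?ys"
    using run(2) by (intro nth_equalityI) (auto simp: fin_def nth_append)
  moreover have "R 0 + R 1 \<le> 2 ^ w"
    using run(2) len_out by (simp add: fin_def)
  moreover have "length inp < 2 ^ w" "\<forall>x \<in> set inp. x < 2 ^ w"
    using len1 inp_small by (auto dest: add_lessD1 Suc_lessD)
  ultimately show ?thesis
    using run(1) T' unfolding computes_within_def by blast
qed


section \<open>Size bounds\<close>

lemma length_concat_map_le:
  assumes "\<And>x. x \<in> set xs \<Longrightarrow> length (f x) \<le> b"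
  shows "length (concat (map f xs)) \<le> length xs * b"
  using assms by (induction xs) (auto intro!: add_mono)

text \<open>A leaf word has a symbol, at most \<open>D\<close> digits and a terminator; each block
  adds its separator.\<close>

lemma length_full_text:
  assumes "k + length (layout F) < 2 ^ D"
  shows "length (full_text H k F) \<le> 2 ^ H * (1 + length (layout F) * (D + 2))"
proof -
  have "length (text_block f k F) \<le> length (enumerate k (layout F)) * (D + 2)" for f
    unfolding text_block_def
  proof (rule length_concat_map_le)
    fix q assume q: "q \<in> set (enumerate k (layout F))"
    then have "length (bin_digits (fst q)) \<le> D"
      using assms by (intro length_bin_digits) (auto simp: in_set_enumerate_eq)
    then show "length (text_entry f q) \<le> D + 2"
      by (auto simp: text_entry_def leaf_word_def split: prod.splits)
  qed
  then have "length (5 # text_block f k F) \<le> 1 + length (layout F) * (D + 2)" for f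
    by simp
  from length_concat_map_le[of "[0..<2 ^ H]", OF this] show ?thesis
    by (simp add: full_text_def)
qed

text \<open>A leaf takes 3 codes per digit (bracket, digit, closing bracket) and 24 others. The 4
  counts the bracket, bar and closing bracket of an alternative, and pays for the dummy
  symbol.\<close>

lemma length_full_pattern:
  assumes "k + length (layout F) < 2 ^ D"
  shows "length (rexp_code (full_pattern H k F)) \<le> 2 ^ H * (4 + length (layout F) * (3 * D + 24))"
proof -
  let ?block = "\<lambda>y. concat (map (pattern_entry (pattern_sym H y)) (enumerate k (layout F)))"
  have "length (?block y) \<le> length (enumerate k (layout F)) * (3 * D + 24)" for y
  proof (rule length_concat_map_le)
    fix q assume q: "q \<in> set (enumerate k (layout F))"
    then have "length (bin_digits (fst q)) \<le> D"
      using assms by (intro length_bin_digits) (auto simp: in_set_enumerate_eq)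
    moreover have "length (concat (map (\<lambda>b. [0, b + 4]) bs)) = 2 * length bs" for bs :: "nat list"
      by (induction bs) auto
    ultimately show "length (pattern_entry (pattern_sym H y) q) \<le> 3 * D + 24"
      by (auto simp: pattern_entry_def leaf_code_def split: prod.splits)
  qed
  then have "length (0 # ?block y @ [2]) \<le> 2 + length (layout F) * (3 * D + 24)" for y
    by simp
  from length_concat_map_le[of "[0..<2 ^ H]", OF this]
  have "length (concat (map (\<lambda>y. 0 # ?block y @ [2]) [0..<2 ^ H])) \<le> 2 ^ H * (2 + length (layout F) * (3 * D + 24))"
    by simp
  moreover have "1 \<le> (2::nat) ^ H"
    by simp
  moreover have "length (rexp_code (full_pattern H k F))
      = length (concat (map (\<lambda>y. 0 # ?block y @ [2]) [0..<2 ^ H])) + 1 + 2 ^ H"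
    by (simp add: rexp_code_full_pattern)
  moreover have "(2::nat) ^ H * (4 + length (layout F) * (3 * D + 24))
      = 2 ^ H * (2 + length (layout F) * (3 * D + 24)) + 2 * 2 ^ H"
    by (simp add: algebra_simps)
  ultimately show ?thesis
    by linarith
qed

section \<open>Closed form of the bound\<close>

definition log_bound :: "nat \<Rightarrow> nat" where
  "log_bound s = floor_log s + 4"

definition size_bound :: "nat \<Rightarrow> nat \<Rightarrow> nat" where
  "size_bound n s = 100 * (2 ^ ((n + 1) div 2) * s * log_bound s)"

text \<open>The 4 added in \<open>log_bound\<close> is chosen for this: leaf numbers are below
  \<open>8 * s\<close>, so \<open>log_bound s\<close> digits suffice for them.\<close>

lemma less_power_log_bound: "0 < s \<Longrightarrow> 8 * s < 2 ^ log_bound s"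
proof -
  assume "0 < s"
  then have "s < 2 * 2 ^ floor_log s"
    using floor_log_exp2_gt by simp
  then show ?thesis
    by (simp add: log_bound_def power_add)
qed

text \<open>Rounding \<open>n / 2\<close> up costs at most a factor 2, and the summand 4 in
  \<open>log_bound\<close> turns into a factor 5 by the maximum with 1; with the 100 this makes
  1000.\<close>

lemma size_bound_le:
  assumes "1 \<le> s"
  shows "real (size_bound n s) \<le> 1000 * (2 powr (real n / 2) * real s * max 1 (log 2 (real s)))"
proof -
  let ?H = "(n + 1) div 2" and ?M = "max 1 (log 2 (real s))"
  have "real (2 ^ floor_log s) \<le> real s"
    using floor_log_exp2_le[of s] assms by (intro of_nat_mono) auto
  then have "real (floor_log s) \<le> log 2 (real s)"
    using assms by (intro le_log2_of_power) simp
  then have D: "real (log_bound s) \<le> 5 * ?M"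
    unfolding log_bound_def by (simp add: max_def)
  have "2 * ?H \<le> n + 1"
    by simp
  then have "real (2 * ?H) \<le> real (n + 1)"
    by (rule of_nat_mono)
  then have "real ?H \<le> (real n + 1) / 2"
    unfolding of_nat_mult of_nat_add by simp
  then have "2 powr real ?H \<le> 2 powr (real n / 2 + 1)"
    by (intro powr_mono) auto
  also have "\<dots> = 2 * 2 powr (real n / 2)"
    by (simp add: powr_add)
  finally have H: "(2::real) ^ ?H \<le> 2 * 2 powr (real n / 2)"
    by (simp add: powr_realpow)
  have "(2::real) ^ ?H * real s * real (log_bound s) \<le> (2 * 2 powr (real n / 2)) * real s * (5 * ?M)"
    using H D by (intro mult_mono) auto
  then show ?thesis
    by (simp add: size_bound_def mult_ac)
qed

text \<open>As \<open>d \<ge> 4\<close> and \<open>l < 4 * s\<close>, every summand is at most a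
  constant times \<open>s * d\<close>; the constants are generous. The last two bounds serve to show
  that words fitting the output also fit the stack addresses and the assignments.\<close>

lemma size_bounds:
  fixes s d H l :: nat
  assumes "4 \<le> d" "1 \<le> s" "l + 3 \<le> 4 * s"
  defines "X \<equiv> 2 ^ H * s * d"
  shows "2 ^ H * (1 + l * (d + 2)) \<le> 100 * X" "2 ^ H * (4 + l * (3 * d + 24)) \<le> 100 * X"
    "300 + 103 * l + 2 ^ H * (150 + l * (600 + 200 * d)) \<le> 100 * (100 * X)"
    "4 * s \<le> X" "4 * 2 ^ H \<le> X"
proof -
  have H: "1 \<le> (2::nat) ^ H"
    by simp
  have a: "4 \<le> s * d"
    using mult_le_mono[OF assms(2,1)] by simp
  then show "4 * 2 ^ H \<le> X"
    using mult_le_mono2[of 4 "s * d" "2 ^ H"] by (simp add: X_def mult.assoc mult.commute)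
  have c: "4 * s \<le> s * d"
    using assms(1) by simp
  also have "\<dots> \<le> X"
    using mult_le_mono1[OF H, of "s * d"] by (simp add: X_def mult.assoc)
  finally show "4 * s \<le> X" .
  have b: "l * d \<le> 4 * (s * d)" "l \<le> s * d"
    using mult_le_mono1[of l "4 * s" d] assms(3) c by (simp, linarith)
  have X: "2 ^ H * (m * (s * d)) = m * X" for m
    by (simp add: X_def)
  have "1 + l * d + 2 * l \<le> 100 * (s * d)" "4 + 3 * (l * d) + 24 * l \<le> 100 * (s * d)"
    and time: "450 + 703 * l + 200 * (l * d) \<le> 10000 * (s * d)"
    using a b by linarith+
  moreover have "1 + l * d + 2 * l = 1 + l * (d + 2)" "4 + 3 * (l * d) + 24 * l = 4 + l * (3 * d + 24)"
    by (simp_all add: algebra_simps)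
  ultimately have "1 + l * (d + 2) \<le> 100 * (s * d)" "4 + l * (3 * d + 24) \<le> 100 * (s * d)"
    by metis+
  then show "2 ^ H * (1 + l * (d + 2)) \<le> 100 * X" "2 ^ H * (4 + l * (3 * d + 24)) \<le> 100 * X"
    unfolding X[symmetric] by - (rule mult_le_mono2, assumption)+
  have "450 + 703 * l + 200 * (l * d) = 300 + 103 * l + (150 + l * (600 + 200 * d))"
    by (simp add: algebra_simps)
  with time have "300 + 103 * l + (150 + l * (600 + 200 * d)) \<le> 10000 * (s * d)"
    by simp
  then have "2 ^ H * (300 + 103 * l + (150 + l * (600 + 200 * d))) \<le> 10000 * X"
    unfolding X[symmetric] by (rule mult_le_mono2)
  moreover have "300 + 103 * l + 2 ^ H * (150 + l * (600 + 200 * d))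
      \<le> 2 ^ H * (300 + 103 * l + (150 + l * (600 + 200 * d)))"
    using mult_le_mono1[OF H, of "300 + 103 * l"] unfolding distrib_left[of "2 ^ H" "300 + 103 * l"] by simp
  ultimately show "300 + 103 * l + 2 ^ H * (150 + l * (600 + 200 * d)) \<le> 100 * (100 * X)"
    by linarith
qed

lemma reduction_spec:
  assumes F: "fvars F \<subseteq> {..<n}"
  shows "\<exists>t p. set t \<subseteq> {..<7} \<and> set_rexp p \<subseteq> {..<7} \<and>
    length t \<le> size_bound n (leaves F) \<and> rexp_length p \<le> size_bound n (leaves F) \<and>
    ((\<exists>u. sublist u t \<and> u \<in> lang p) \<longleftrightarrow> satisfiable F) \<and>
    (\<forall>w. 10 * size_bound n (leaves F) \<le> 2 ^ w \<longrightarrow>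
      computes_within w reduction_program (input_code n F) (output_code t p) (100 * size_bound n (leaves F)))"
proof -
  let ?s = "leaves F" and ?H = "(n + 1) div 2" and ?k = "length (input_code n F)"
  let ?D = "log_bound ?s"
  define X where "X = 2 ^ ?H * ?s * ?D"
  define t where "t = full_text ?H ?k F"
  define p where "p = full_pattern ?H ?k F"
  have s: "1 \<le> ?s"
    using leaves_pos[of F] by simp
  have k: "?k = 2 * ?s"
    using length_formula_code[of F] by (simp add: input_code_def)
  have D: "?k + length (layout F) < 2 ^ ?D"
    using k length_layout[of F] less_power_log_bound[of ?s] s by simp
  have N: "size_bound n ?s = 100 * X"
    by (simp add: size_bound_def X_def)
  have "4 \<le> ?D"
    by (simp add: log_bound_def)
  note bounds = size_bounds[OF this s length_layout, of ?H, folded X_def]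
  have len_t: "length t \<le> 100 * X"
    using length_full_text[OF D, of ?H] bounds(1) by (simp add: t_def)
  have len_p: "length (rexp_code p) \<le> 100 * X"
    using length_full_pattern[OF D, of ?H] bounds(2) by (simp only: p_def)
  have "set t \<subseteq> {..<7}"
    using set_full_text[of ?H ?k F] by (auto simp: t_def)
  moreover have "set_rexp p \<subseteq> {..<7}"
    unfolding p_def by (rule set_full_pattern)
  \<comment> \<open>The half is rounded up, so \<open>2 * ?H\<close> covers all \<open>n\<close>
    variables.\<close>
  moreover have "(\<exists>u. sublist u t \<and> u \<in> lang p) \<longleftrightarrow> satisfiable F"
    unfolding t_def p_def using F by (intro reduction_correct) auto
  moreover have "rexp_length p \<le> size_bound n ?s"
    using len_p by (simp add: rexp_length_def N)
  moreover have "computes_within w reduction_program (input_code n F) (output_code t p) (100 * size_bound n ?s)"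
    if "10 * size_bound n ?s \<le> 2 ^ w" for w
  proof -
    have w: "1000 * X \<le> 2 ^ w"
      using that by (simp add: N)
    \<comment> \<open>Together with \<open>n \<le> 2 * ?H\<close> this bounds \<open>n\<close> by
      \<open>X\<close>, even if few of the variables occur in \<open>F\<close>.\<close>
    have "?H < 2 ^ ?H" "1 \<le> (2::nat) ^ ?H"
      by simp_all
    then have X: "n \<le> X" "1 \<le> X" "2 ^ ?H \<le> X" "4 * ?s \<le> X"
      using bounds(4,5) by linarith+
    have "computes_within w reduction_program (input_code n F) (output_code t p)
      (300 + 103 * length (layout F) + 2 ^ ?H * (150 + length (layout F) * (600 + 200 * ?D)))"
      unfolding t_def p_def
    proof (rule reduction_program_correct[OF _ F _ _ _ _ D])
      show "?k + length (layout F) + 1 + length (full_text ?H ?k F)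
          + length (rexp_code (full_pattern ?H ?k F)) < 2 ^ w"
        using k length_layout[of F] len_t len_p X w unfolding t_def p_def by linarith
    qed (use X w in linarith)+
    then show ?thesis
      using bounds(3) unfolding computes_within_def N by (meson order_trans)
  qed
  ultimately show ?thesis
    using len_t N by (intro exI[of _ t] exI[of _ p]) simp
qed

theorem theorem1p4:
  "\<exists>(A :: program) (\<sigma> :: nat) (N :: nat \<Rightarrow> nat \<Rightarrow> nat) (C :: real) (D :: nat) (B :: nat).
    (\<forall>n s. 1 \<le> n \<longrightarrow> 1 \<le> s \<longrightarrow>
      real (N n s) \<le> C * (2 powr (real n / 2) * real s * max 1 (log 2 (real s)))) \<and>
    (\<forall>n F. fvars F \<subseteq> {..<n} \<longrightarrow>
      (\<exists>(t :: nat list) (p :: nat rexp).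
        set t \<subseteq> {..<\<sigma>} \<and> set_rexp p \<subseteq> {..<\<sigma>} \<and>
        length t \<le> N n (leaves F) \<and> rexp_length p \<le> N n (leaves F) \<and>
        ((\<exists>u. sublist u t \<and> u \<in> lang p) \<longleftrightarrow> satisfiable F) \<and>
        (\<forall>w. B * N n (leaves F) \<le> 2 ^ w \<longrightarrow>
          computes_within w A (input_code n F) (output_code t p) (D * N n (leaves F)))))"
proof (intro exI conjI)
  show "\<forall>n s. 1 \<le> n \<longrightarrow> 1 \<le> s \<longrightarrow>
      real (size_bound n s) \<le> 1000 * (2 powr (real n / 2) * real s * max 1 (log 2 (real s)))"
    using size_bound_le by blast
\<comment> \<open>Unification with \<open>reduction_spec\<close> supplies the program, the alphabet
  size 7, the time factor 100 and the word factor 10.\<close>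
qed (intro allI impI, erule reduction_spec)

end
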